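(* Let $n\ge2$ and $\mathbf t=(t_0,u_0,t,t_n,u_n)\in\mathbb C^5$. The polynomial representation $\pi:\mathcal H(\mathbf t)\to\mathrm{End}(\mathcal P)$ of the rational double affine Hecke algebra $\mathcal H(\mathbf t)$, given on generators by $$(\pi(T_i)p)(x)=c_i(x)(s_ip)(x)-d_i(x)p(x)\ \ (i\in[0,n]),\qquad (\pi(X_i)p)(x)=x_ip(x)\ \ (i\in[1,n]),$$ is faithful.
   Context: Notation: $[m,n]=\{m,m+1,\dots,n\}$, $\mathcal P=\mathbb C[x_1,\dots,x_n]$. $W$ is the affine Weyl group of type $\widetilde C_n$: the Coxeter group with generators $s_0,\dots,s_n$ and relations $s_i^2=1$; $s_is_{i+1}s_is_{i+1}=s_{i+1}s_is_{i+1}s_i$ for $i=0,n-1$; $s_is_{i+1}s_i=s_{i+1}s_is_{i+1}$ for $i\in[1,n-2]$; $s_is_j=s_js_i$ for $|i-j|\ge2$. $W$ acts on $\mathbb C^n$ by $s_0x=(1-x_1,x_2,\dots,x_n)$, $s_i$ interchanges $x_i$ and $x_{i+1}$ ($i\in[1,n-1]$), $s_nx=(x_1,\dots,x_{n-1},-x_n)$, and on functions by $(wp)(x)=p(w^{-1}x)$. Put $a_0(x)=1-2x_1$, $a_i(x)=x_i-x_{i+1}$ ($i\in[1,n-1]$), $a_n(x)=2x_n$, and $a_0^\vee(x)=\tfrac12-x_1$, $a_n^\vee(x)=x_n$. Put $k_0=2t_0+2u_0$, $k_i=t$ for $i\in[1,n-1]$, $k_n=2t_n+2u_n$. The degenerate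 (trigonometric) double affine Hecke algebra $\mathfrak H(\mathbf k)$ is the unital associative complex algebra generated by the group algebra $\mathbb C[W]$ (with generators $r_0,\dots,r_n$ corresponding to $s_0,\dots,s_n$) and $\mathbb C[X_1,\dots,X_n]$, such that $\mathfrak H(\mathbf k)\simeq\mathbb C[W]\otimes\mathbb C[X_1,\dots,X_n]$ as a vector space via multiplication, with cross-relations $$r_ip(X)-(s_ip)(X)r_i=\frac{k_i}{a_i(X)}\big((s_ip)(X)-p(X)\big),\qquad i\in[0,n],\ p\in\mathcal P .$$ $H$ is the subalgebra of $\mathfrak H(\mathbf k)$ generated by $T_i=r_i$ ($i\in[1,n-1]$) and $T_i=t_i+\tfrac12\big(t_i-u_i+a_i^\vee(X)\big)(r_i-1)$ for $i=0,n$; $\mathcal H(\mathbf t)$ is the subalgebra generated by $H$ and $X_1,\dots,X_n$. Put $\chi_0=t_0$, $\chi_n=t_n$, $\chi_i=1$ for $i\in[1,n-1]$; $d_i(x)=\big(t_i^2-u_i^2+a_i^\vee(x)^2\big)/a_i(x)$ for $i=0,n$; $d_i(x)=t/a_i(x)$ for $i\in[1,n-1]$; $c_i(x)=d_i(x)+\chi_i$. The representation $\pi$ is the representation of $\mathcal H(\mathbf t)$ induced from the one-dimensional representation $T_i\mapsto\chi_i$ ($i\in[0,n]$) of $H$, where $\mathcal H\simeq\mathbb C[X_1,\dots,X_n]\otimes H$ and $\mathbb C[X_1,\dots,X_n]$ is identified with $\mathcal P$. *)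

theory Defs
  imports "HOL-Algebra.QuotRing" "HOL-Algebra.Generated_Rings" "HOL-Library.Poly_Mapping"
    Complex_Main
begin

section \<open>Polynomials and the action of the affine Weyl group\<close>

text \<open>
  A point of \<open>\<complex>\<^sup>n\<close> is a function \<open>x :: nat \<Rightarrow> complex\<close> of which only the coordinates
  \<open>x 1, \<dots>, x n\<close> matter. The algebra of polynomials in \<open>n\<close> variables over the infinite field
  of complex numbers is represented by polynomial functions; they involve the
  coordinates \<open>1, \<dots>, n\<close> only.
\<close>

type_synonym cfun = "(nat \<Rightarrow> complex) \<Rightarrow> complex"

inductive_set polys :: "nat \<Rightarrow> cfun set" for n :: nat where
  const: "(\<lambda>x. c) \<in> polys n"
| coord: "1 \<le> j \<Longrightarrow> j \<le> n \<Longrightarrow> (\<lambda>x. x j) \<in> polys n"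
| add: "p \<in> polys n \<Longrightarrow> q \<in> polys n \<Longrightarrow> (\<lambda>x. p x + q x) \<in> polys n"
| mult: "p \<in> polys n \<Longrightarrow> q \<in> polys n \<Longrightarrow> (\<lambda>x. p x * q x) \<in> polys n"

definition refl_pt :: "nat \<Rightarrow> nat \<Rightarrow> (nat \<Rightarrow> complex) \<Rightarrow> (nat \<Rightarrow> complex)" where
  "refl_pt n i x =
     (if i = 0 then x(1 := 1 - x 1)
      else if i = n then x(n := - x n)
      else x(i := x (i + 1), i + 1 := x i))"

text \<open>
  The action on functions is \<open>(w p)(x) = p (w\<^sup>-\<^sup>1 x)\<close>; the generators \<open>s\<^sub>i\<close> are involutions, so no
  inverse is needed here.
\<close>

definition refl_act :: "nat \<Rightarrow> nat \<Rightarrow> cfun \<Rightarrow> cfun" where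
  "refl_act n i p = (\<lambda>x. p (refl_pt n i x))"

definition aroot :: "nat \<Rightarrow> nat \<Rightarrow> cfun" where
  "aroot n i x =
     (if i = 0 then 1 - 2 * x 1 else if i = n then 2 * x n else x i - x (i + 1))"

text \<open>Only used for \<open>i = 0\<close> and \<open>i = n\<close>.\<close>

definition acheck :: "nat \<Rightarrow> nat \<Rightarrow> cfun" where
  "acheck n i x = (if i = 0 then 1 / 2 - x 1 else x n)"


section \<open>Parameters\<close>

record daha_params =
  par_t0 :: complex
  par_u0 :: complex
  par_t :: complex
  par_tn :: complex
  par_un :: complex

definition kpar :: "nat \<Rightarrow> daha_params \<Rightarrow> nat \<Rightarrow> complex" where
  "kpar n t i =
     (if i = 0 then 2 * par_t0 t + 2 * par_u0 t
      else if i = n then 2 * par_tn t + 2 * par_un t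
      else par_t t)"

text \<open>The parameters \<open>t\<^sub>i\<close>, \<open>u\<^sub>i\<close>; only used for \<open>i = 0\<close> and \<open>i = n\<close>.\<close>

definition tpar :: "daha_params \<Rightarrow> nat \<Rightarrow> complex" where
  "tpar t i = (if i = 0 then par_t0 t else par_tn t)"

definition upar :: "daha_params \<Rightarrow> nat \<Rightarrow> complex" where
  "upar t i = (if i = 0 then par_u0 t else par_un t)"

definition chi :: "nat \<Rightarrow> daha_params \<Rightarrow> nat \<Rightarrow> complex" where
  "chi n t i = (if i = 0 \<or> i = n then tpar t i else 1)"

definition dfct :: "nat \<Rightarrow> daha_params \<Rightarrow> nat \<Rightarrow> cfun" where
  "dfct n t i x =
     (if i = 0 \<or> i = n
      then ((tpar t i)\<^sup>2 - (upar t i)\<^sup>2 + (acheck n i x)\<^sup>2) / aroot n i x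
      else par_t t / aroot n i x)"

definition cfct :: "nat \<Rightarrow> daha_params \<Rightarrow> nat \<Rightarrow> cfun" where
  "cfct n t i x = dfct n t i x + chi n t i"


section \<open>Complex algebras\<close>

text \<open>
  A unital complex algebra is given by a ring \<open>A\<close> of HOL-Algebra together with its structure map
  \<open>a :: complex \<Rightarrow> _\<close>, \<open>a c\<close> being the multiple by \<open>c\<close> of the unit.
\<close>

definition subalg :: "('a, 'm) ring_scheme \<Rightarrow> (complex \<Rightarrow> 'a) \<Rightarrow> 'a set \<Rightarrow> 'a set" where
  "subalg A a S = generate_ring A (range a \<union> S)"

definition alg_hom ::
  "('a, 'm) ring_scheme \<Rightarrow> (complex \<Rightarrow> 'a) \<Rightarrow> ('b, 'k) ring_scheme \<Rightarrow> (complex \<Rightarrow> 'b) \<Rightarrow> ('a \<Rightarrow> 'b) set"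
  where "alg_hom A a B b = {f \<in> ring_hom A B. \<forall>c. f (a c) = b c}"

definition complex_ring :: "complex ring" where
  "complex_ring = \<lparr>carrier = UNIV, mult = (*), one = 1, zero = 0, add = (+)\<rparr>"

definition poly_End :: "nat \<Rightarrow> (cfun \<Rightarrow> cfun) ring" where
  "poly_End n =
    \<lparr>carrier = {f \<in> polys n \<rightarrow>\<^sub>E polys n.
        (\<forall>p\<in>polys n. \<forall>q\<in>polys n. f (\<lambda>x. p x + q x) = (\<lambda>x. f p x + f q x)) \<and>
        (\<forall>c. \<forall>p\<in>polys n. f (\<lambda>x. c * p x) = (\<lambda>x. c * f p x))},
     mult = (\<lambda>f g. compose (polys n) f g),
     one = (\<lambda>p\<in>polys n. p),
     zero = (\<lambda>p\<in>polys n. (\<lambda>x. 0)),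
     add = (\<lambda>f g. \<lambda>p\<in>polys n. (\<lambda>x. f p x + g p x))\<rparr>"

definition poly_End_scal :: "nat \<Rightarrow> complex \<Rightarrow> cfun \<Rightarrow> cfun" where
  "poly_End_scal n c = (\<lambda>p\<in>polys n. (\<lambda>x. c * p x))"


section \<open>The degenerate (trigonometric) double affine Hecke algebra\<close>

text \<open>
  With words as additive monoid, \<open>'a list \<Rightarrow>\<^sub>0 complex\<close> with its convolution product is the
  free complex algebra on \<open>'a\<close>.
\<close>

instantiation list :: (type) monoid_add
begin

definition zero_list :: "'a list" where "zero_list = []"

definition plus_list :: "'a list \<Rightarrow> 'a list \<Rightarrow> 'a list" where "plus_list v w = v @ w"

instance by standard (simp_all add: zero_list_def plus_list_def)

end

text \<open>The symbols \<open>r\<^sub>i\<close> and the symbols \<open>p(X)\<close>, one for each polynomial \<open>p\<close>.\<close>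

datatype gen = Refl nat | Pol cfun

type_synonym free = "gen list \<Rightarrow>\<^sub>0 complex"

definition gens :: "nat \<Rightarrow> gen set" where
  "gens n = Refl ` {0..n} \<union> Pol ` polys n"

definition free_alg :: "nat \<Rightarrow> free ring" where
  "free_alg n =
    \<lparr>carrier = {a. \<forall>w \<in> Poly_Mapping.keys a. set w \<subseteq> gens n},
     mult = (*), one = 1, zero = 0, add = (+)\<rparr>"

definition fR :: "nat \<Rightarrow> free" where
  "fR i = Poly_Mapping.single [Refl i] 1"

definition fP :: "cfun \<Rightarrow> free" where
  "fP p = Poly_Mapping.single [Pol p] 1"

definition fC :: "complex \<Rightarrow> free" where
  "fC c = Poly_Mapping.single [] c"

text \<open>
  An element \<open>lhs - rhs\<close> for each relation \<open>lhs = rhs\<close>: the Coxeter relations (presenting the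
  group algebra of \<open>W\<close>), the relations making \<open>p \<mapsto> p(X)\<close> a homomorphism of unital complex
  algebras (presenting the polynomial algebra), and the cross-relations. In the latter, \<open>q\<close> is
  the polynomial \<open>k\<^sub>i (s\<^sub>i p - p) / a\<^sub>i\<close>; it is unique because \<open>a\<^sub>i\<close> is a nonzero polynomial.
\<close>

inductive_set relators :: "nat \<Rightarrow> daha_params \<Rightarrow> free set" for n :: nat and t :: daha_params where
  invol: "i \<le> n \<Longrightarrow> fR i * fR i - 1 \<in> relators n t"
| braid4: "i \<in> {0, n - 1} \<Longrightarrow>
    fR i * fR (i + 1) * fR i * fR (i + 1) - fR (i + 1) * fR i * fR (i + 1) * fR i
      \<in> relators n t"
| braid3: "1 \<le> i \<Longrightarrow> i + 2 \<le> n \<Longrightarrow>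
    fR i * fR (i + 1) * fR i - fR (i + 1) * fR i * fR (i + 1) \<in> relators n t"
| commute: "i \<le> n \<Longrightarrow> j \<le> n \<Longrightarrow> i + 2 \<le> j \<Longrightarrow> fR i * fR j - fR j * fR i \<in> relators n t"
| pol_const: "fP (\<lambda>x. c) - fC c \<in> relators n t"
| pol_add: "p \<in> polys n \<Longrightarrow> q \<in> polys n \<Longrightarrow>
    fP (\<lambda>x. p x + q x) - (fP p + fP q) \<in> relators n t"
| pol_mult: "p \<in> polys n \<Longrightarrow> q \<in> polys n \<Longrightarrow>
    fP (\<lambda>x. p x * q x) - fP p * fP q \<in> relators n t"
| cross: "i \<le> n \<Longrightarrow> p \<in> polys n \<Longrightarrow> q \<in> polys n \<Longrightarrow>
    \<forall>x. aroot n i x * q x = kpar n t i * (refl_act n i p x - p x) \<Longrightarrow>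
    (fR i * fP p - fP (refl_act n i p) * fR i) - fP q \<in> relators n t"

text \<open>
  This is the algebra generated by \<open>\<complex>[W]\<close> and \<open>\<complex>[X\<^sub>1, \<dots>, X\<^sub>n]\<close> subject to the
  cross-relations. The cross-relations show that multiplication maps
  \<open>\<complex>[W] \<otimes> \<complex>[X\<^sub>1, \<dots>, X\<^sub>n]\<close> onto it; that this map is bijective (the
  Poincare-Birkhoff-Witt property) is a theorem about the presentation, not an extra condition.
\<close>

definition trig_daha :: "nat \<Rightarrow> daha_params \<Rightarrow> free set ring" where
  "trig_daha n t = free_alg n Quot (Idl\<^bsub>free_alg n\<^esub> (relators n t))"

definition cls :: "nat \<Rightarrow> daha_params \<Rightarrow> free \<Rightarrow> free set" where
  "cls n t a = (Idl\<^bsub>free_alg n\<^esub> (relators n t)) +>\<^bsub>free_alg n\<^esub> a"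

definition scal :: "nat \<Rightarrow> daha_params \<Rightarrow> complex \<Rightarrow> free set" where
  "scal n t c = cls n t (fC c)"

definition polX :: "nat \<Rightarrow> daha_params \<Rightarrow> cfun \<Rightarrow> free set" where
  "polX n t p = cls n t (fP p)"

definition Xgen :: "nat \<Rightarrow> daha_params \<Rightarrow> nat \<Rightarrow> free set" where
  "Xgen n t j = polX n t (\<lambda>x. x j)"

definition Tgen :: "nat \<Rightarrow> daha_params \<Rightarrow> nat \<Rightarrow> free set" where
  "Tgen n t i =
     (if i = 0 \<or> i = n
      then cls n t (fC (tpar t i) +
             fC (1 / 2) * (fC (tpar t i) - fC (upar t i) + fP (acheck n i)) * (fR i - 1))
      else cls n t (fR i))"


section \<open>The rational double affine Hecke algebra and its polynomial representation\<close>

definition hecke_H :: "nat \<Rightarrow> daha_params \<Rightarrow> free set ring" where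
  "hecke_H n t =
     (trig_daha n t)\<lparr>carrier := subalg (trig_daha n t) (scal n t) (Tgen n t ` {0..n})\<rparr>"

definition rat_daha :: "nat \<Rightarrow> daha_params \<Rightarrow> free set ring" where
  "rat_daha n t =
     (trig_daha n t)\<lparr>carrier :=
        subalg (trig_daha n t) (scal n t) (carrier (hecke_H n t) \<union> Xgen n t ` {1..n})\<rparr>"

definition triv_char :: "nat \<Rightarrow> daha_params \<Rightarrow> free set \<Rightarrow> complex" where
  "triv_char n t =
     (THE f. f \<in> extensional (carrier (hecke_H n t)) \<and>
             f \<in> alg_hom (hecke_H n t) (scal n t) complex_ring (\<lambda>c. c) \<and>
             (\<forall>i\<le>n. f (Tgen n t i) = chi n t i))"

text \<open>
  The induced module is the tensor product over \<open>H\<close> of the rational double affine Hecke algebra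
  with the one-dimensional \<open>H\<close>-module. It is the quotient of the
  former by the left ideal generated by the elements \<open>h - \<chi>(h)\<close>, \<open>h \<in> H\<close>.
\<close>

definition ind_kernel :: "nat \<Rightarrow> daha_params \<Rightarrow> free set set" where
  "ind_kernel n t =
     generate (add_monoid (rat_daha n t))
       {a \<otimes>\<^bsub>rat_daha n t\<^esub> (h \<ominus>\<^bsub>rat_daha n t\<^esub> scal n t (triv_char n t h)) | a h.
          a \<in> carrier (rat_daha n t) \<and> h \<in> carrier (hecke_H n t)}"

definition ind_class :: "nat \<Rightarrow> daha_params \<Rightarrow> free set \<Rightarrow> free set set" where
  "ind_class n t h = ind_kernel n t +>\<^bsub>rat_daha n t\<^esub> h"

text \<open>
  The induced module is identified with the space of polynomials by \<open>q \<mapsto> ind_class (q(X))\<close>;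
  under this identification \<open>h\<close> acts by left multiplication on classes.
\<close>

definition poly_rep :: "nat \<Rightarrow> daha_params \<Rightarrow> free set \<Rightarrow> cfun \<Rightarrow> cfun" where
  "poly_rep n t h =
     (\<lambda>p\<in>polys n. THE q. q \<in> polys n \<and>
        ind_class n t (polX n t q) = ind_class n t (h \<otimes>\<^bsub>rat_daha n t\<^esub> polX n t p))"

end

theory Submission
  imports Defs "HOL-Computational_Algebra.Polynomial"
begin

text \<open>
  The trigonometric algebra acts on \<open>polys n\<close> with \<open>r\<^sub>i\<close> acting by \<open>s\<^sub>i + (k\<^sub>i / a\<^sub>i) (s\<^sub>i - 1)\<close>, and this
  action is faithful: the algebra is spanned by the elements \<open>p(X) r\<^sub>w\<close>; at a generic point, the operator
  \<open>r\<^sub>w\<close> is a nonzero multiple of the group element \<open>w\<close> plus a combination of shorter ones; and the finitely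
  many group elements involved move that point to distinct points, which polynomials separate. That the \<open>r\<^sub>w\<close>
  are indexed by transformations rather than by words is the word problem for the Coxeter presentation,
  solved by a diamond argument on the orbit of a point of the fundamental alcove.
  The induced representation is the restriction of this action: the
  character of \<open>H\<close> describes its action on constants, and the defining left ideal of the induced module
  annihilates the constant \<open>1\<close>.
\<close>

section \<open>Polynomial functions and the trigonometric Dunkl action\<close>

text \<open>The algebra is given by a presentation, so neither the independence of the products
  \<open>p(X) r_w\<close> nor the existence of the character of \<open>H\<close> can be read off
  from the definitions; both are extracted from the action. This action is the module induced from
  the trivial representation of the affine Weyl group: every \<open>r_i\<close> fixes the constant
  1, and so \<open>T_i\<close> multiplies it by \<chi>. Faithfulness of the trigonometric action is
  also a means of calculation. Two elements of the algebra agree once they act alike on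
  \<open>polys n\<close>, and thus computations modulo the relations, in particular those inside the
  left ideal \<open>ind_kernel\<close>, turn into computations with operators. The parameters are
  arbitrary. The coefficient \<open>1 + k_i / a_i\<close> of the reflection in the operator
  \<open>r_i\<close> is never identically zero as a function of the point, and a generic point
  avoids its zeros. Division by roots makes sense only off hyperplanes, so identities between
  polynomials are proved on the complement of finitely many of them.\<close>

lemma polys_uminus: "p \<in> polys n \<Longrightarrow> (\<lambda>x. - p x) \<in> polys n"
  using polys.mult[OF polys.const[of "-1"]] by simp

lemma polys_diff: "p \<in> polys n \<Longrightarrow> q \<in> polys n \<Longrightarrow> (\<lambda>x. p x - q x) \<in> polys n"
  using polys.add[OF _ polys_uminus] by simp

lemma polys_prod: "finite F \<Longrightarrow> (\<And>i. i \<in> F \<Longrightarrow> f i \<in> polys n) \<Longrightarrow> (\<lambda>x. \<Prod>i\<in>F. f i x) \<in> polys n"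
  by (induction F rule: finite_induct) (auto intro: polys.intros)

lemma polys_sum: "finite F \<Longrightarrow> (\<And>i. i \<in> F \<Longrightarrow> f i \<in> polys n) \<Longrightarrow> (\<lambda>x. \<Sum>i\<in>F. f i x) \<in> polys n"
  by (induction F rule: finite_induct) (auto intro: polys.intros)

lemmas polys_intros = polys.intros polys_uminus polys_diff

lemma polys_refl_act: assumes "n \<ge> 2" "i \<le> n" "p \<in> polys n" shows "refl_act n i p \<in> polys n"
  using assms(3)
proof induction
  case (coord j)
  then show ?case using assms(1,2) unfolding refl_act_def refl_pt_def
    by (cases "i = 0"; cases "i = n"; cases "j = i"; cases "j = i + 1"; cases "j = 1") (auto intro!: polys_intros)
qed (auto simp: refl_act_def intro: polys_intros)

lemma polys_aroot: "n \<ge> 2 \<Longrightarrow> i \<le> n \<Longrightarrow> aroot n i \<in> polys n"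
  unfolding aroot_def by (cases "i = 0"; cases "i = n") (auto intro!: polys_intros)

lemma polys_acheck: "n \<ge> 2 \<Longrightarrow> acheck n i \<in> polys n"
  unfolding acheck_def by (cases "i = 0") (auto intro!: polys_intros)

text \<open>Restriction to the line through \<open>x\<close> and \<open>y\<close> reduces questions
  about several variables to univariate polynomials.\<close>

lemma polys_line:
  assumes "p \<in> polys n"
  shows "\<exists>P. \<forall>s. p (\<lambda>j. x j + s * (y j - x j)) = poly P s"
  using assms
proof induction
  case (const c) show ?case by (rule exI[of _ "[:c:]"]) simp
next
  case (coord j) show ?case by (rule exI[of _ "[:x j, y j - x j:]"]) simp
next
  case (add p q) then show ?case by (metis poly_add)
next
  case (mult p q) then show ?case by (metis poly_mult)
qed

text \<open>On the line joining \<open>x\<close> and \<open>y\<close> both functions restrict to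
  nonzero univariate polynomials, and the product of these is nonzero, hence has a nonzero
  value.\<close>

lemma polys_mult_nonzero:
  assumes "p \<in> polys n" "q \<in> polys n" "p x \<noteq> 0" "q y \<noteq> 0"
  shows "\<exists>z. p z \<noteq> 0 \<and> q z \<noteq> 0"
proof -
  obtain P where P: "p (\<lambda>j. x j + s * (y j - x j)) = poly P s" for s
    using polys_line[OF assms(1)] by blast
  obtain Q where Q: "q (\<lambda>j. x j + s * (y j - x j)) = poly Q s" for s
    using polys_line[OF assms(2)] by blast
  have "P \<noteq> 0" "Q \<noteq> 0" using P[of 0] Q[of 1] assms by auto
  then have "P * Q \<noteq> 0" by simp
  then obtain s where "poly (P * Q) s \<noteq> 0" by (metis poly_all_0_iff_0)
  then show ?thesis using P Q by (metis mult_eq_0_iff poly_mult)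
qed

lemma polys_common_nonzero:
  assumes "finite F" "\<And>f. f \<in> F \<Longrightarrow> f \<in> polys n" "\<And>f. f \<in> F \<Longrightarrow> \<exists>x. f x \<noteq> 0"
  shows "\<exists>x. \<forall>f\<in>F. f x \<noteq> 0"
  using assms
proof (induction F rule: finite_induct)
  case (insert f F)
  then obtain x y where x: "\<forall>f\<in>F. f x \<noteq> 0" and y: "f y \<noteq> 0" by (metis insertCI)
  have "(\<lambda>x. \<Prod>g\<in>F. g x) \<in> polys n" using insert by (intro polys_prod) auto
  from polys_mult_nonzero[OF this, of f x y] insert x y
  obtain z where "(\<Prod>g\<in>F. g z) \<noteq> 0" "f z \<noteq> 0" by auto
  then show ?case using insert.hyps by auto
qed simp

text \<open>The density principle behind every computation with division by roots: if
  \<open>p - q\<close> were not zero, it would be nonzero at a point where all members of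
  \<open>F\<close> are nonzero too.\<close>

lemma polys_eqI:
  assumes "p \<in> polys n" "q \<in> polys n" "finite F" "F \<subseteq> polys n" "\<And>f. f \<in> F \<Longrightarrow> \<exists>x. f x \<noteq> 0"
    and "\<And>x. (\<And>f. f \<in> F \<Longrightarrow> f x \<noteq> 0) \<Longrightarrow> p x = q x"
  shows "p = q"
proof (rule ccontr)
  assume "p \<noteq> q"
  then have *: "\<exists>x. p x - q x \<noteq> 0" by (metis ext right_minus_eq)
  have "\<exists>x. \<forall>f\<in>insert (\<lambda>x. p x - q x) F. f x \<noteq> 0"
    by (rule polys_common_nonzero[where n=n]) (use assms * in \<open>auto intro!: polys_diff\<close>)
  then show False using assms(6) by auto
qed

lemma polys_separate:
  assumes "finite Z" "\<And>z. z \<in> Z \<Longrightarrow> \<exists>j\<in>{1..n}. z j \<noteq> z0 j"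
  shows "\<exists>p\<in>polys n. p z0 \<noteq> 0 \<and> (\<forall>z\<in>Z. p z = 0)"
  using assms
proof (induction Z rule: finite_induct)
  case empty show ?case by (rule bexI[of _ "\<lambda>x. 1"]) (auto intro: polys.intros)
next
  case (insert z Z)
  then obtain p where p: "p \<in> polys n" "p z0 \<noteq> 0" "\<forall>z\<in>Z. p z = 0" by blast
  obtain j where j: "j \<in> {1..n}" "z j \<noteq> z0 j" using insert.prems[OF insertI1] by blast
  show ?case
    by (rule bexI[of _ "\<lambda>x. p x * (x j - z j)"]) (use p j in \<open>auto intro!: polys_intros\<close>)
qed

section \<open>Divided differences and the operators of the simple reflections\<close>

lemma aroot_takes:
  assumes "n \<ge> 2" "i \<le> n" shows "\<exists>x. aroot n i x = c"
  by (rule exI[of _ "if i = 0 then (\<lambda>_. (1 - c) / 2) else if i = n then (\<lambda>_. c / 2) else (\<lambda>j. if j = i then c else 0)"])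
    (use assms in \<open>auto simp: aroot_def field_simps\<close>)

lemma refl_pt_invol: "refl_pt n i (refl_pt n i x) = x"
  by (auto simp: refl_pt_def fun_eq_iff)

lemma aroot_refl_pt:
  "n \<ge> 2 \<Longrightarrow> i \<le> n \<Longrightarrow> aroot n i (refl_pt n i x) = - aroot n i x"
  by (auto simp: aroot_def refl_pt_def)

text \<open>Products inherit divisibility by the root through the twisted Leibniz rule
  \<open>D (p q) = (s p) (D q) + (D p) q\<close> for the divided difference \<open>D\<close>. On
  coordinates the quotient is one of the constants 0, 1 and -1.\<close>

lemma divided_difference_exists:
  assumes n: "n \<ge> 2" "i \<le> n" and p: "p \<in> polys n"
  shows "\<exists>q\<in>polys n. \<forall>x. aroot n i x * q x = refl_act n i p x - p x"
  using p
proof induction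
  case (const c)
  show ?case by (rule bexI[of _ "\<lambda>x. 0"]) (auto simp: refl_act_def intro: polys_intros)
next
  case (coord j)
  let ?c = "if i = 0 then (if j = 1 then 1 else 0) else if i = n then (if j = n then -1 else 0)
     else if j = i then -1 else if j = i + 1 then 1 else (0::complex)"
  show ?case by (rule bexI[of _ "\<lambda>x. ?c"])
     (use n coord in \<open>auto simp: refl_act_def refl_pt_def aroot_def intro: polys_intros\<close>)
next
  case (add p q)
  then obtain p' q' where "p' \<in> polys n" "q' \<in> polys n"
    "\<forall>x. aroot n i x * p' x = refl_act n i p x - p x" "\<forall>x. aroot n i x * q' x = refl_act n i q x - q x"
    by blast
  then show ?case by (intro bexI[of _ "\<lambda>x. p' x + q' x"])
     (auto simp: refl_act_def distrib_left intro: polys_intros)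
next
  case (mult p q)
  then obtain p' q' where *: "p' \<in> polys n" "q' \<in> polys n"
    "\<forall>x. aroot n i x * p' x = refl_act n i p x - p x" "\<forall>x. aroot n i x * q' x = refl_act n i q x - q x"
    by blast
  have "aroot n i x * (refl_act n i p x * q' x + p' x * q x) = refl_act n i (\<lambda>x. p x * q x) x - p x * q x" for x
  proof -
    have "aroot n i x * (refl_act n i p x * q' x + p' x * q x) =
        refl_act n i p x * (aroot n i x * q' x) + (aroot n i x * p' x) * q x"
      by (simp add: algebra_simps)
    also have "\<dots> = refl_act n i (\<lambda>x. p x * q x) x - p x * q x"
      unfolding spec[OF *(3)] spec[OF *(4)] by (simp add: refl_act_def algebra_simps)
    finally show ?thesis .
  qed
  moreover have "(\<lambda>x. refl_act n i p x * q' x + p' x * q x) \<in> polys n"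
    using * mult n by (intro polys.add polys.mult polys_refl_act) auto
  ultimately show ?case by (intro bexI) auto
qed

text \<open>A polynomial is chosen, instead of dividing pointwise, in order to have the right values
  on the hyperplane where the root vanishes.\<close>

definition divided_difference :: "nat \<Rightarrow> nat \<Rightarrow> cfun \<Rightarrow> cfun" where
  "divided_difference n i p = (SOME q. q \<in> polys n \<and> (\<forall>x. aroot n i x * q x = refl_act n i p x - p x))"

text \<open>Obtained by applying the cross-relation to \<open>r_i p(X)\<close> and letting
  \<open>r_i\<close> fix the constant 1.\<close>

definition dunkl :: "nat \<Rightarrow> daha_params \<Rightarrow> nat \<Rightarrow> cfun \<Rightarrow> cfun" where
  "dunkl n t i p = (\<lambda>x. refl_act n i p x + kpar n t i * divided_difference n i p x)"

lemma divided_difference: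
  assumes "n \<ge> 2" "i \<le> n" "p \<in> polys n"
  shows "divided_difference n i p \<in> polys n"
    "aroot n i x * divided_difference n i p x = refl_act n i p x - p x"
  using someI_ex[of "\<lambda>q. q \<in> polys n \<and> (\<forall>x. aroot n i x * q x = refl_act n i p x - p x)"]
    divided_difference_exists[OF assms] unfolding divided_difference_def by auto

lemma dunkl_polys: "n \<ge> 2 \<Longrightarrow> i \<le> n \<Longrightarrow> p \<in> polys n \<Longrightarrow> dunkl n t i p \<in> polys n"
  unfolding dunkl_def by (intro polys_intros polys_refl_act divided_difference)

lemma dunkl_eq:
  assumes "n \<ge> 2" "i \<le> n" "p \<in> polys n" "aroot n i x \<noteq> 0"
  shows "dunkl n t i p x = (1 + kpar n t i / aroot n i x) * p (refl_pt n i x) - kpar n t i / aroot n i x * p x"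
proof -
  have *: "divided_difference n i p x = (p (refl_pt n i x) - p x) / aroot n i x"
    using divided_difference(2)[OF assms(1-3), of x] assms(4)
    by (simp add: field_simps refl_act_def)
  show ?thesis unfolding dunkl_def refl_act_def * by (simp add: algebra_simps diff_divide_distrib)
qed

lemma polys_eqI_aroot:
  assumes "n \<ge> 2" "p \<in> polys n" "q \<in> polys n" "i \<le> n" and "\<And>x. aroot n i x \<noteq> 0 \<Longrightarrow> p x = q x"
  shows "p = q"
proof (rule polys_eqI[where F = "{aroot n i}" and n = n])
  show "\<exists>x. f x \<noteq> 0" if "f \<in> {aroot n i}" for f
    using that aroot_takes[OF assms(1,4), of 1] by auto (metis one_neq_zero)
qed (use assms polys_aroot in auto)

lemma dunkl_add:
  assumes "n \<ge> 2" "i \<le> n" "p \<in> polys n" "q \<in> polys n"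
  shows "dunkl n t i (\<lambda>x. p x + q x) = (\<lambda>x. dunkl n t i p x + dunkl n t i q x)"
  by (rule polys_eqI_aroot[where i=i, OF assms(1)])
     (use assms in \<open>auto intro!: dunkl_polys polys_intros simp: dunkl_eq polys.intros algebra_simps add_divide_distrib\<close>)

lemma dunkl_scale:
  assumes "n \<ge> 2" "i \<le> n" "p \<in> polys n"
  shows "dunkl n t i (\<lambda>x. c * p x) = (\<lambda>x. c * dunkl n t i p x)"
  by (rule polys_eqI_aroot[where i=i, OF assms(1)])
     (use assms in \<open>auto intro!: dunkl_polys polys_intros simp: dunkl_eq polys.intros algebra_simps add_divide_distrib\<close>)

lemma dunkl_invol:
  assumes "n \<ge> 2" "i \<le> n" "p \<in> polys n"
  shows "dunkl n t i (dunkl n t i p) = p"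
  by (rule polys_eqI_aroot[where i=i, OF assms(1)])
     (use assms in \<open>auto intro!: dunkl_polys polys_intros simp: dunkl_eq dunkl_polys aroot_refl_pt refl_pt_invol field_simps\<close>)

section \<open>The Coxeter relations between these operators\<close>

lemma polys_fold_refl_pt:
  assumes "n \<ge> 2" "p \<in> polys n" "set v \<subseteq> {0..n}"
  shows "(\<lambda>x. p (fold (refl_pt n) v x)) \<in> polys n"
  using assms(3)
proof (induction v)
  case Nil then show ?case using assms(2) by simp
next
  case (Cons j v)
  then show ?case using polys_refl_act[OF assms(1), of j "\<lambda>x. p (fold (refl_pt n) v x)"]
    by (simp add: refl_act_def)
qed

lemma polys_aroot_comp:
  assumes "n \<ge> 2" "i \<le> n" "set v \<subseteq> {0..n}"
  shows "(\<lambda>x. aroot n i (fold (refl_pt n) v x)) \<in> polys n"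
    "\<exists>x. aroot n i (fold (refl_pt n) v x) = c"
proof -
  show "(\<lambda>x. aroot n i (fold (refl_pt n) v x)) \<in> polys n"
    by (rule polys_fold_refl_pt[OF assms(1) polys_aroot[OF assms(1,2)] assms(3)])
  have "fold (refl_pt n) v (fold (refl_pt n) (rev v) x) = x" for x
    by (induction v arbitrary: x) (auto simp: refl_pt_invol)
  then show "\<exists>x. aroot n i (fold (refl_pt n) v x) = c" using aroot_takes[OF assms(1,2), of c] by metis
qed

text \<open>A pair \<open>(i, v)\<close> in \<open>A\<close> names the hyperplane where the root
  \<open>a_i\<close> vanishes after the point has been moved along \<open>v\<close>; compositions of
  operators divide by such transformed roots.\<close>

lemma polys_eqI_aroot_comp:
  assumes "n \<ge> 2" "p \<in> polys n" "q \<in> polys n"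
    and "finite A" "A \<subseteq> {(i, v). i \<le> n \<and> set v \<subseteq> {0..n}}"
    and "\<And>x. (\<And>i v. (i, v) \<in> A \<Longrightarrow> aroot n i (fold (refl_pt n) v x) \<noteq> 0) \<Longrightarrow> p x = q x"
  shows "p = q"
proof (rule polys_eqI[OF assms(2,3), where F = "(\<lambda>(i, v) x. aroot n i (fold (refl_pt n) v x)) ` A"])
  show "(\<lambda>(i, v) x. aroot n i (fold (refl_pt n) v x)) ` A \<subseteq> polys n"
    using polys_aroot_comp(1)[OF assms(1)] assms(5) by auto
  show "\<exists>x. f x \<noteq> 0" if "f \<in> (\<lambda>(i, v) x. aroot n i (fold (refl_pt n) v x)) ` A" for f
  proof -
    obtain a where "a \<in> A" "f = (case a of (i, v) \<Rightarrow> \<lambda>x. aroot n i (fold (refl_pt n) v x))"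
      using \<open>f \<in> _\<close> by blast
    then obtain i v where "i \<le> n" "set v \<subseteq> {0..n}" "f = (\<lambda>x. aroot n i (fold (refl_pt n) v x))"
      using assms(5) by (cases a) auto
    then show ?thesis using polys_aroot_comp(2)[OF assms(1), of i v 1] by auto (metis one_neq_zero)
  qed
  show "p x = q x" if "\<And>f. f \<in> (\<lambda>(i, v) x. aroot n i (fold (refl_pt n) v x)) ` A \<Longrightarrow> f x \<noteq> 0" for x
    using that by (intro assms(6)) (metis (mono_tags, lifting) case_prod_conv image_eqI)
qed (use assms in auto)

text \<open>The hypotheses of the two braid identities are the quadratic relations between the functions \<open>k\<^sub>\<alpha> / \<alpha>\<close>, with
  \<open>\<alpha>\<close> a positive root of type \<open>A\<^sub>2\<close> or \<open>B\<^sub>2\<close>; the variables \<open>q\<close> stand for values at the images of a point.\<close>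

lemma braid3_identity:
  fixes a b c :: "'a::comm_ring_1"
  assumes "a * b = c * (a + b)"
  shows "(1 + a) * ((1 + c) * ((1 + b) * q121 - b * q21) - c * ((1 + - a) * q0 - - a * q1))
    - a * ((1 + b) * ((1 + c) * q12 - c * q2) - b * ((1 + a) * q1 - a * q0))
  = (1 + b) * ((1 + c) * ((1 + a) * q121 - a * q12) - c * ((1 + - b) * q0 - - b * q2))
    - b * ((1 + a) * ((1 + c) * q21 - c * q1) - a * ((1 + b) * q2 - b * q0))" (is "?l = ?r")
proof -
  \<comment> \<open>The terms in \<open>q121\<close>, \<open>q12\<close> and \<open>q21\<close>
    cancel, and what remains is divisible by the quadratic relation.\<close>
  have "?l - ?r = (a * b - c * (a + b)) * ((1 + a) * q1 - (1 + b) * q2 - (a - b) * q0)"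
    by (simp add: algebra_simps)
  then show ?thesis using assms by simp
qed

lemma braid4_identity:
  fixes a a' b b' :: "'a::comm_ring_1"
  assumes "a * (b - b') = a' * (b + b')"
  shows
   "(1 + a) * ((1 + b') * ((1 + a') * ((1 + b) * qLSLS - b * qLSL) - a' * ((1 + - b') * qL - - b' * qSL))
       - b' * ((1 + - a) * ((1 + b) * qS - b * q0) - - a * ((1 + b') * qSL - b' * qL)))
    - a * ((1 + b) * ((1 + a') * ((1 + b') * qSLS - b' * qLS) - a' * ((1 + - b) * q0 - - b * qS))
       - b * ((1 + a) * ((1 + b') * qSL - b' * qL) - a * ((1 + b) * qS - b * q0))) 
   = (1 + b) * ((1 + a') * ((1 + b') * ((1 + a) * qLSLS - a * qSLS) - b' * ((1 + - a') * qS - - a' * qLS))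
       - a' * ((1 + - b) * ((1 + a) * qL - a * q0) - - b * ((1 + a') * qLS - a' * qS)))
    - b * ((1 + a) * ((1 + b') * ((1 + a') * qLSL - a' * qSL) - b' * ((1 + - a) * q0 - - a * qL))
       - a * ((1 + b) * ((1 + a') * qLS - a' * qS) - b * ((1 + a) * qL - a * q0)))" (is "?l = ?r")
proof -
  have "?l - ?r = (a * (b - b') - a' * (b + b')) * ((1 + a) * (1 + b') * qSL - (1 + b) * (1 + a') * qLS
     + (1 + a) * (b - b') * qL - (1 + b) * (a - a') * qS)"
    by (simp add: algebra_simps)
  then show ?thesis using assms by simp
qed

text \<open>The hypotheses are the Cartan data of a pair of type \<open>A_2\<close>. The three
  hyperplanes avoided belong to the positive roots \<open>a_i\<close>, \<open>a_j\<close> and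
  \<open>a_i + a_j\<close>; up to sign, no other root is met along the six images of a
  point.\<close>

lemma dunkl_braid3:
  fixes n i j
  assumes n: "n \<ge> 2" "i \<le> n" "j \<le> n" and p: "p \<in> polys n"
    and k: "kpar n t i = kpar n t j"
    and ij: "\<And>x. aroot n i (refl_pt n j x) = aroot n i x + aroot n j x"
    and ji: "\<And>x. aroot n j (refl_pt n i x) = aroot n j x + aroot n i x"
    and br: "\<And>x. refl_pt n i (refl_pt n j (refl_pt n i x)) = refl_pt n j (refl_pt n i (refl_pt n j x))"
  shows "dunkl n t i (dunkl n t j (dunkl n t i p)) = dunkl n t j (dunkl n t i (dunkl n t j p))"
proof (rule polys_eqI_aroot_comp[where A = "{(i, []), (j, []), (i, [j])}", OF n(1)])
  fix x assume "\<And>l v. (l, v) \<in> {(i, []), (j, []), (i, [j])} \<Longrightarrow> aroot n l (fold (refl_pt n) v x) \<noteq> 0"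
  from this[of i "[]"] this[of j "[]"] this[of i "[j]"]
  have nz: "aroot n i x \<noteq> 0" "aroot n j x \<noteq> 0" "aroot n i x + aroot n j x \<noteq> 0" by (auto simp: ij)
  define si sj where "si = refl_pt n i" and "sj = refl_pt n j"
  define u v where "u = (\<lambda>x. kpar n t j / aroot n i x)" and "v = (\<lambda>x. kpar n t j / aroot n j x)"
  define a b c where "a = u x" and "b = v x" and "c = kpar n t j / (aroot n i x + aroot n j x)"
  have Di: "dunkl n t i q y = (1 + u y) * q (si y) - u y * q y" if "q \<in> polys n" "aroot n i y \<noteq> 0" for q y
    using dunkl_eq[OF n(1,2) that, of t] by (simp add: u_def si_def k)
  have Dj: "dunkl n t j q y = (1 + v y) * q (sj y) - v y * q y" if "q \<in> polys n" "aroot n j y \<noteq> 0" for q y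
    using dunkl_eq[OF n(1,3) that, of t] by (simp add: v_def sj_def)
  note root = ij ji aroot_refl_pt[OF n(1,2)] aroot_refl_pt[OF n(1,3)]
  have roots: "aroot n i (si x) = - aroot n i x" "aroot n j (si x) = aroot n i x + aroot n j x"
    "aroot n i (sj x) = aroot n i x + aroot n j x" "aroot n j (sj x) = - aroot n j x"
    "aroot n i (sj (si x)) = aroot n j x" "aroot n j (si (sj x)) = aroot n i x"
    by (simp_all add: root si_def sj_def)
  have uv: "u x = a" "v x = b" "u (si x) = - a" "v (si x) = c" "u (sj x) = c" "v (sj x) = - b"
    "u (sj (si x)) = b" "v (si (sj x)) = a"
    unfolding u_def v_def roots a_def b_def c_def by (simp_all add: roots)
  have inv: "si (si y) = y" "sj (sj y) = y" "si (sj (si x)) = sj (si (sj x))" for y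
    by (simp_all add: si_def sj_def refl_pt_invol br)
  \<comment> \<open>With \<alpha> and \<beta> the two roots, this is 1/(\<alpha> \<beta>) =
    (1/\<alpha> + 1/\<beta>)/(\<alpha> + \<beta>), multiplied by the square of the common
    parameter.\<close>
  have "a * b = c * (a + b)"
    unfolding a_def b_def c_def u_def v_def using nz by (simp add: divide_simps) (simp add: algebra_simps)
  from braid3_identity[OF this]
  show "dunkl n t i (dunkl n t j (dunkl n t i p)) x = dunkl n t j (dunkl n t i (dunkl n t j p)) x"
    by (simp only: Di Dj nz roots uv inv dunkl_polys n p neg_equal_0_iff_equal not_False_eq_True)
qed (use n p in \<open>auto intro: dunkl_polys\<close>)

text \<open>Type \<open>B_2\<close>, with \<open>i\<close> at the long root and \<open>j\<close> at
  the short one. The positive roots are \<open>a_i\<close>, \<open>a_j\<close>,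
  \<open>a_i + 2 a_j\<close> and \<open>a_i + a_j\<close>, and the parameters of the two lengths are
  independent.\<close>

lemma dunkl_braid4:
  fixes n i j
  assumes n: "n \<ge> 2" "i \<le> n" "j \<le> n" and p: "p \<in> polys n"
    and ij: "\<And>x. aroot n i (refl_pt n j x) = aroot n i x + 2 * aroot n j x"
    and ji: "\<And>x. aroot n j (refl_pt n i x) = aroot n j x + aroot n i x"
    and br: "\<And>x. refl_pt n i (refl_pt n j (refl_pt n i (refl_pt n j x))) = refl_pt n j (refl_pt n i (refl_pt n j (refl_pt n i x)))"
  shows "dunkl n t i (dunkl n t j (dunkl n t i (dunkl n t j p))) = dunkl n t j (dunkl n t i (dunkl n t j (dunkl n t i p)))"
proof (rule polys_eqI_aroot_comp[where A = "{(i, []), (j, []), (i, [j]), (j, [i])}", OF n(1)])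
  fix x assume "\<And>l v. (l, v) \<in> {(i, []), (j, []), (i, [j]), (j, [i])} \<Longrightarrow> aroot n l (fold (refl_pt n) v x) \<noteq> 0"
  from this[of i "[]"] this[of j "[]"] this[of i "[j]"] this[of j "[i]"]
  have nz: "aroot n i x \<noteq> 0" "aroot n j x \<noteq> 0" "aroot n i x + 2 * aroot n j x \<noteq> 0"
    "aroot n j x + aroot n i x \<noteq> 0" by (auto simp: ij ji)
  define si sj where "si = refl_pt n i" and "sj = refl_pt n j"
  define u v where "u = (\<lambda>x. kpar n t i / aroot n i x)" and "v = (\<lambda>x. kpar n t j / aroot n j x)"
  define a b a' b' where "a = u x" and "b = v x" and "a' = kpar n t i / (aroot n i x + 2 * aroot n j x)"
    and "b' = kpar n t j / (aroot n j x + aroot n i x)"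
  have Di: "dunkl n t i q y = (1 + u y) * q (si y) - u y * q y" if "q \<in> polys n" "aroot n i y \<noteq> 0" for q y
    using dunkl_eq[OF n(1,2) that, of t] by (simp add: u_def si_def)
  have Dj: "dunkl n t j q y = (1 + v y) * q (sj y) - v y * q y" if "q \<in> polys n" "aroot n j y \<noteq> 0" for q y
    using dunkl_eq[OF n(1,3) that, of t] by (simp add: v_def sj_def)
  note root = ij ji aroot_refl_pt[OF n(1,2)] aroot_refl_pt[OF n(1,3)]
  have roots: "aroot n i (si x) = - aroot n i x" "aroot n j (si x) = aroot n j x + aroot n i x"
    "aroot n i (sj x) = aroot n i x + 2 * aroot n j x" "aroot n j (sj x) = - aroot n j x"
    "aroot n i (sj (si x)) = aroot n i x + 2 * aroot n j x" "aroot n j (sj (si x)) = - (aroot n j x + aroot n i x)"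
    "aroot n j (si (sj x)) = aroot n j x + aroot n i x" "aroot n i (si (sj x)) = - (aroot n i x + 2 * aroot n j x)"
    "aroot n j (si (sj (si x))) = aroot n j x" "aroot n i (sj (si (sj x))) = aroot n i x"
    by (simp_all add: root si_def sj_def)
  have uv: "u x = a" "v x = b" "u (si x) = - a" "v (si x) = b'" "u (sj x) = a'" "v (sj x) = - b"
    "u (sj (si x)) = a'" "v (sj (si x)) = - b'" "v (si (sj x)) = b'" "u (si (sj x)) = - a'"
    "v (si (sj (si x))) = b" "u (sj (si (sj x))) = a"
    unfolding u_def v_def roots a_def b_def a'_def b'_def by (simp_all only: divide_minus_right)
  have inv: "si (si y) = y" "sj (sj y) = y" "si (sj (si (sj x))) = sj (si (sj (si x)))" for y
    by (simp_all add: si_def sj_def refl_pt_invol br)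
  have "a * (b - b') = a' * (b + b')"
    unfolding a_def b_def a'_def b'_def u_def v_def using nz by (simp add: divide_simps) (simp add: algebra_simps)
  from braid4_identity[OF this]
  show "dunkl n t i (dunkl n t j (dunkl n t i (dunkl n t j p))) x = dunkl n t j (dunkl n t i (dunkl n t j (dunkl n t i p))) x"
    by (simp only: Di Dj nz roots uv inv dunkl_polys n p neg_equal_0_iff_equal not_False_eq_True)
qed (use n p in \<open>auto intro: dunkl_polys\<close>)

lemma dunkl_commute:
  fixes n i j
  assumes n: "n \<ge> 2" "i \<le> n" "j \<le> n" and p: "p \<in> polys n"
    and ij: "\<And>x. aroot n i (refl_pt n j x) = aroot n i x"
    and ji: "\<And>x. aroot n j (refl_pt n i x) = aroot n j x"
    and br: "\<And>x. refl_pt n i (refl_pt n j x) = refl_pt n j (refl_pt n i x)"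
  shows "dunkl n t i (dunkl n t j p) = dunkl n t j (dunkl n t i p)"
proof (rule polys_eqI_aroot_comp[where A = "{(i, []), (j, [])}", OF n(1)])
  fix x assume "\<And>l v. (l, v) \<in> {(i, []), (j, [])} \<Longrightarrow> aroot n l (fold (refl_pt n) v x) \<noteq> 0"
  from this[of i "[]"] this[of j "[]"]
  have nz: "aroot n i x \<noteq> 0" "aroot n j x \<noteq> 0" by auto
  define u v where "u = kpar n t i / aroot n i x" and "v = kpar n t j / aroot n j x"
  show "dunkl n t i (dunkl n t j p) x = dunkl n t j (dunkl n t i p) x"
    by (simp add: dunkl_eq nz n p dunkl_polys ij ji flip: u_def v_def) (simp add: br algebra_simps)
qed (use n p in \<open>auto intro: dunkl_polys\<close>)

section \<open>The word problem for the affine Weyl group\<close>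

text \<open>Words are applied by \<open>fold\<close>, that is, from left to right, so that appending a letter to a word
  multiplies on the right by a generator.\<close>

inductive coxeq :: "nat \<Rightarrow> nat list \<Rightarrow> nat list \<Rightarrow> bool" for n where
  refl: "coxeq n u u"
| sym: "coxeq n u v \<Longrightarrow> coxeq n v u"
| trans: "coxeq n u v \<Longrightarrow> coxeq n v w \<Longrightarrow> coxeq n u w"
| ctxt: "set a \<subseteq> {0..n} \<Longrightarrow> set b \<subseteq> {0..n} \<Longrightarrow> coxeq n u v \<Longrightarrow> coxeq n (a @ u @ b) (a @ v @ b)"
| invol: "i \<le> n \<Longrightarrow> coxeq n [i, i] []"
| braid4: "i \<in> {0, n - 1} \<Longrightarrow> coxeq n [i, i + 1, i, i + 1] [i + 1, i, i + 1, i]"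
| braid3: "1 \<le> i \<Longrightarrow> i + 2 \<le> n \<Longrightarrow> coxeq n [i, i + 1, i] [i + 1, i, i + 1]"
| commute: "i \<le> n \<Longrightarrow> j \<le> n \<Longrightarrow> i + 2 \<le> j \<Longrightarrow> coxeq n [i, j] [j, i]"

text \<open>The affine action on \<open>\<complex>\<^sup>n\<close> dilated by \<open>2n + 1\<close>, so that the point \<open>(n, \<dots>, 1)\<close> lies in the open
  fundamental alcove and its orbit consists of integer points.\<close>

definition irefl :: "nat \<Rightarrow> nat \<Rightarrow> (nat \<Rightarrow> int) \<Rightarrow> (nat \<Rightarrow> int)" where
  "irefl n i y =
     (if i = 0 then y(1 := 2 * int n + 1 - y 1)
      else if i = n then y(n := - y n)
      else y(i := y (i + 1), i + 1 := y i))"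

definition iroot :: "nat \<Rightarrow> nat \<Rightarrow> (nat \<Rightarrow> int) \<Rightarrow> int" where
  "iroot n i y = (if i = 0 then 2 * int n + 1 - 2 * y 1 else if i = n then 2 * y n else y i - y (i + 1))"

definition base_pt :: "nat \<Rightarrow> nat \<Rightarrow> int" where
  "base_pt n j = int n + 1 - int j"

text \<open>The congruences survive signed permutations of the coordinates and translations of a
  coordinate by \<open>2 * n + 1\<close>; the set turns out to be exactly the orbit of the base
  point. Coordinates outside \<open>{1..n}\<close> are frozen so that equal points are equal
  functions.\<close>

definition regular_pts :: "nat \<Rightarrow> (nat \<Rightarrow> int) set" where
  "regular_pts n = {y. (\<forall>j. j \<notin> {1..n} \<longrightarrow> y j = base_pt n j) \<and>
     (\<forall>j\<in>{1..n}. \<not> 2 * int n + 1 dvd y j) \<and>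
     (\<forall>i\<in>{1..n}. \<forall>j\<in>{1..n}. i \<noteq> j \<longrightarrow> \<not> 2 * int n + 1 dvd y i - y j \<and> \<not> 2 * int n + 1 dvd y i + y j)}"

text \<open>The induction measure, in place of the Coxeter length.\<close>

definition base_dist :: "nat \<Rightarrow> (nat \<Rightarrow> int) \<Rightarrow> nat" where
  "base_dist n y = nat (\<Sum>j\<in>{1..n}. (y j - base_pt n j)\<^sup>2)"

section \<open>The orbit of the base point\<close>

lemma irefl_invol: "irefl n i (irefl n i y) = y"
  by (auto simp: irefl_def fun_eq_iff)

lemma iroot_irefl: "n \<ge> 2 \<Longrightarrow> i \<le> n \<Longrightarrow> iroot n i (irefl n i y) = - iroot n i y"
  by (auto simp: irefl_def iroot_def)

lemma not_dvd_small: "0 < (a::int) \<Longrightarrow> a < m \<Longrightarrow> \<not> m dvd a"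
  using zdvd_imp_le by fastforce

lemma base_pt_regular: "base_pt n \<in> regular_pts n"
proof -
  have "\<not> 2 * int n + 1 dvd base_pt n i - base_pt n j" if "i \<in> {1..n}" "j \<in> {1..n}" "i \<noteq> j" for i j
  proof (cases "i < j")
    case True then show ?thesis using that by (intro not_dvd_small) (auto simp: base_pt_def)
  next
    case False
    then have "\<not> 2 * int n + 1 dvd base_pt n j - base_pt n i"
      using that by (intro not_dvd_small) (auto simp: base_pt_def)
    then show ?thesis by (simp add: dvd_diff_commute)
  qed
  moreover have "\<not> 2 * int n + 1 dvd base_pt n i" if "i \<in> {1..n}" for i
    using that by (intro not_dvd_small) (auto simp: base_pt_def)
  moreover have "\<not> 2 * int n + 1 dvd base_pt n i + base_pt n j" if "i \<in> {1..n}" "j \<in> {1..n}" "i \<noteq> j" for i j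
    using that by (intro not_dvd_small) (auto simp: base_pt_def)
  ultimately show ?thesis unfolding regular_pts_def by blast
qed

lemma irefl_regular:
  assumes "n \<ge> 2" "i \<le> n" "y \<in> regular_pts n"
  shows "irefl n i y \<in> regular_pts n"
proof -
  define N where "N = 2 * int n + 1"
  \<comment> \<open>Modulo \<open>N\<close> the translation in \<open>irefl n 0\<close> disappears,
    so every reflection only permutes coordinates or changes a sign.\<close>
  have sgn: "N dvd - a - b \<longleftrightarrow> N dvd a + b" "N dvd - a + b \<longleftrightarrow> N dvd a - b" "N dvd a - - b \<longleftrightarrow> N dvd a + b"
     "N dvd N - a \<longleftrightarrow> N dvd a" "N dvd N - a - b \<longleftrightarrow> N dvd a + b" "N dvd b - (N - a) \<longleftrightarrow> N dvd a + b"
     "N dvd N - a + b \<longleftrightarrow> N dvd a - b"  "N dvd b + (N - a) \<longleftrightarrow> N dvd a - b" for a b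
     by (presburger | smt (verit) dvd_add_triv_left_iff dvd_minus_iff add.commute dvd_diff_commute)+
  have comm: "N dvd a - b \<longleftrightarrow> N dvd b - a" "N dvd a + b \<longleftrightarrow> N dvd b + a" for a b
    by (simp_all add: dvd_diff_commute add.commute)
  show ?thesis using assms unfolding regular_pts_def irefl_def N_def[symmetric]
    by (cases "i = 0"; cases "i = n") (auto simp: sgn comm)
qed

lemma regular_pts_iroot:
  assumes "n \<ge> 2" "i \<le> n" "y \<in> regular_pts n"
  shows "iroot n i y \<noteq> 0"
proof -
  consider "i = 0" | "i = n" | "1 \<le> i" "i + 1 \<le> n" using assms by linarith
  then show ?thesis
  proof cases
    \<comment> \<open>An odd number minus an even one is not zero.\<close>
    case 1 then show ?thesis unfolding iroot_def by presburger
  next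
    case 2
    then have "\<not> 2 * int n + 1 dvd y n" using assms by (auto simp: regular_pts_def)
    then have "y n \<noteq> 0" by auto
    then show ?thesis using 2 assms by (auto simp: iroot_def)
  next
    case 3
    then have "\<not> 2 * int n + 1 dvd y i - y (i + 1)" using assms by (auto simp: regular_pts_def)
    then have "y i - y (i + 1) \<noteq> 0" by (metis dvd_0_right)
    then show ?thesis using 3 by (auto simp: iroot_def)
  qed
qed

text \<open>The base point lies on the positive side of every wall, so reflecting a point from the
  negative side brings it closer. Only the coordinates in \<open>K\<close> change.\<close>

lemma base_dist_irefl:
  assumes "n \<ge> 2" "i \<le> n" "iroot n i y < 0"
  shows "base_dist n (irefl n i y) < base_dist n y"
proof -
  let ?f = "\<lambda>y j. (y j - base_pt n j)\<^sup>2"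
  have pos: "0 \<le> (\<Sum>j\<in>{1..n}. ?f z j)" for z by (intro sum_nonneg) auto
  have split: "(\<Sum>j\<in>{1..n}. g j) = sum g K + sum g ({1..n} - K)" if "K \<subseteq> {1..n}" for K and g :: "nat \<Rightarrow> int"
    using that by (metis add.commute finite_atLeastAtMost sum.subset_diff)
  have main: "base_dist n (irefl n i y) < base_dist n y"
    if K: "K \<subseteq> {1..n}" and same: "\<And>j. j \<notin> K \<Longrightarrow> irefl n i y j = y j"
    and less: "sum (?f (irefl n i y)) K < sum (?f y) K" for K
  proof -
    have "sum (?f (irefl n i y)) ({1..n} - K) = sum (?f y) ({1..n} - K)"
      by (rule sum.cong) (auto simp: same)
    then have "(\<Sum>j\<in>{1..n}. ?f (irefl n i y) j) < (\<Sum>j\<in>{1..n}. ?f y j)"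
      using less split[OF K] by simp
    then show ?thesis unfolding base_dist_def using pos[of y] pos[of "irefl n i y"] by simp
  qed
  consider "i = 0" | "i = n" "i \<noteq> 0" | "1 \<le> i" "i + 1 \<le> n" using assms by linarith
  then show ?thesis
  proof cases
    case 1
    have "0 < (2 * y 1 - (2 * int n + 1))" using assms 1 by (auto simp: iroot_def)
    then have "(2 * int n + 1 - y 1 - int n)\<^sup>2 < (y 1 - int n)\<^sup>2"
      by (simp add: power2_eq_square algebra_simps)
    then show ?thesis using 1 assms by (intro main[of "{1}"]) (auto simp: irefl_def base_pt_def)
  next
    case 2
    have "y n < 0" using assms 2 by (auto simp: iroot_def)
    then have "(- y n - 1)\<^sup>2 < (y n - 1)\<^sup>2" by (simp add: power2_eq_square algebra_simps)
    then show ?thesis using 2 assms by (intro main[of "{n}"]) (auto simp: irefl_def base_pt_def)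
  next
    case 3
    have "y i < y (i + 1)" using assms 3 by (auto simp: iroot_def)
    then have "(y (i + 1) - base_pt n i)\<^sup>2 + (y i - base_pt n (i + 1))\<^sup>2
        < (y i - base_pt n i)\<^sup>2 + (y (i + 1) - base_pt n (i + 1))\<^sup>2"
      by (simp add: power2_eq_square base_pt_def algebra_simps)
    then show ?thesis using 3 assms by (intro main[of "{i, i + 1}"]) (auto simp: irefl_def)
  qed
qed

text \<open>Positivity of the roots gives integers with n \<ge> y 1 > ... > y n \<ge> 1, and there
  is only one such chain. The upper bound is \<open>2 * y 1 < 2 * n + 1\<close> rounded
  down.\<close>

lemma regular_dominant_eq_base_pt:
  assumes "n \<ge> 2" "y \<in> regular_pts n" "\<And>i. i \<le> n \<Longrightarrow> iroot n i y > 0"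
  shows "y = base_pt n"
proof -
  have step: "y (j + 1) + 1 \<le> y j" if "1 \<le> j" "j < n" for j
    using assms(3)[of j] that by (auto simp: iroot_def)
  have top: "y 1 \<le> int n" using assms(3)[of 0] by (auto simp: iroot_def)
  have bot: "1 \<le> y n" using assms(1) assms(3)[of n] by (auto simp: iroot_def)
  have up: "y j \<le> base_pt n j" if "1 \<le> j" "j \<le> n" for j
    using that
  proof (induction j rule: dec_induct)
    case base then show ?case using top by (simp add: base_pt_def)
  next
    case (step m) then show ?case using \<open>\<And>j. 1 \<le> j \<Longrightarrow> j < n \<Longrightarrow> y (j + 1) + 1 \<le> y j\<close>[of m] by (simp add: base_pt_def)
  qed
  have low: "base_pt n (n - k) \<le> y (n - k)" if "k < n" for k
    using that
  proof (induction k)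
    case 0 then show ?case using bot by (simp add: base_pt_def)
  next
    case (Suc k)
    then have "y (n - k) + 1 \<le> y (n - Suc k)" using step[of "n - Suc k"] by (simp add: Suc_diff_Suc)
    then show ?case using Suc by (simp add: base_pt_def of_nat_diff)
  qed
  show ?thesis
  proof
    fix j show "y j = base_pt n j"
    proof (cases "j \<in> {1..n}")
      case True
      then show ?thesis using up[of j] low[of "n - j"] by auto
    next
      case False then show ?thesis using assms(2) by (simp add: regular_pts_def)
    qed
  qed
qed

text \<open>Each letter is applied on the positive side of its wall. Starting at the base point,
  these are the reduced words, described without a length function.\<close>

fun ascending :: "nat \<Rightarrow> nat list \<Rightarrow> (nat \<Rightarrow> int) \<Rightarrow> bool" where
  "ascending n [] y \<longleftrightarrow> True"
| "ascending n (i # w) y \<longleftrightarrow> i \<le> n \<and> iroot n i y > 0 \<and> ascending n w (irefl n i y)"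

lemma ascending_append:
  "ascending n (u @ v) y \<longleftrightarrow> ascending n u y \<and> ascending n v (fold (irefl n) u y)"
  by (induction u arbitrary: y) auto

lemma ascending_set: "ascending n w y \<Longrightarrow> set w \<subseteq> {0..n}"
  by (induction w arbitrary: y) auto

lemma fold_irefl_regular:
  "n \<ge> 2 \<Longrightarrow> set w \<subseteq> {0..n} \<Longrightarrow> y \<in> regular_pts n \<Longrightarrow> fold (irefl n) w y \<in> regular_pts n"
  by (induction w arbitrary: y) (auto simp: irefl_regular)

text \<open>Greedy descent: reflecting in a negative root lowers the distance, and a regular point
  without negative roots is the base point.\<close>

lemma ascending_word_exists:
  assumes "n \<ge> 2" "y \<in> regular_pts n"
  shows "\<exists>w. ascending n w (base_pt n) \<and> fold (irefl n) w (base_pt n) = y"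
  using assms(2)
proof (induction "base_dist n y" arbitrary: y rule: less_induct)
  case less
  show ?case
  proof (cases "\<exists>i\<le>n. iroot n i y < 0")
    case True
    then obtain i where i: "i \<le> n" "iroot n i y < 0" by blast
    obtain w where "ascending n w (base_pt n)" "fold (irefl n) w (base_pt n) = irefl n i y"
      using less.hyps[OF base_dist_irefl[OF assms(1) i] irefl_regular[OF assms(1) i(1) less.prems]] by blast
    then have "ascending n (w @ [i]) (base_pt n)" "fold (irefl n) (w @ [i]) (base_pt n) = y"
      using i assms(1) by (auto simp: ascending_append iroot_irefl irefl_invol)
    then show ?thesis by blast
  next
    case False
    then have "iroot n i y > 0" if "i \<le> n" for i
      using that regular_pts_iroot[OF assms(1) that less.prems] by (meson linorder_neqE_linordered_idom)
    then have "y = base_pt n" by (intro regular_dominant_eq_base_pt[OF assms(1) less.prems])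
    then show ?thesis by (intro exI[of _ "[]"]) auto
  qed
qed

text \<open>Both descents continue to the lowest point of the orbit of \<open>y\<close> under the
  dihedral group generated by the two reflections. The two ways down spell its longest element, and
  their reversals differ by one braid or commutation move. The cases are the possible rank-two
  types: commuting, \<open>A_2\<close>, and \<open>B_2\<close> at either end of the diagram.\<close>

lemma descents_diamond:
  assumes n: "n \<ge> 2" and ij: "i < j" "j \<le> n" and neg: "iroot n i y < 0" "iroot n j y < 0"
  shows "\<exists>s s'. ascending n (rev (i # s)) (fold (irefl n) (i # s) y) \<and>
      ascending n (rev (j # s')) (fold (irefl n) (j # s') y) \<and>
      fold (irefl n) (i # s) y = fold (irefl n) (j # s') y \<and> coxeq n (rev (i # s)) (rev (j # s'))"
proof -
  consider "i + 2 \<le> j" | "1 \<le> i" "j = i + 1" "i + 2 \<le> n" | "i = 0" "j = 1" | "1 \<le> i" "j = i + 1" "n = i + 1"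
    using ij by linarith
  then show ?thesis
  proof cases
    case 1
    then have "coxeq n (rev [i, j]) (rev [j, i])" using ij coxeq.sym[OF coxeq.commute[of i n j]] by simp
    then show ?thesis using 1 ij neg n by (intro exI[of _ "[j]"] exI[of _ "[i]"])
      (auto simp: irefl_def iroot_def fun_eq_iff split: if_splits)
  next
    case 2
    then have "coxeq n (rev [i, j, i]) (rev [j, i, j])" using ij coxeq.braid3[of i n] by simp
    then show ?thesis using 2 neg n by (intro exI[of _ "[j, i]"] exI[of _ "[i, j]"])
      (auto simp: irefl_def iroot_def fun_eq_iff)
  next
    case 3
    then have "coxeq n (rev [i, j, i, j]) (rev [j, i, j, i])" using coxeq.braid4[of 0 n] by (auto intro: coxeq.sym)
    then show ?thesis using 3 neg n by (intro exI[of _ "[j, i, j]"] exI[of _ "[i, j, i]"])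
      (auto simp: irefl_def iroot_def fun_eq_iff)
  next
    case 4
    then have "coxeq n (rev [i, j, i, j]) (rev [j, i, j, i])" using coxeq.braid4[of i n] by (auto intro: coxeq.sym)
    then show ?thesis using 4 neg n by (intro exI[of _ "[j, i, j]"] exI[of _ "[i, j, i]"])
      (auto simp: irefl_def iroot_def fun_eq_iff)
  qed
qed

lemma fold_irefl_rev: "fold (irefl n) (rev w) (fold (irefl n) w y) = y"
  by (induction w arbitrary: y) (auto simp: irefl_invol)

lemma ascending_snocD:
  assumes "n \<ge> 2" "ascending n (w @ [i]) y0" "fold (irefl n) (w @ [i]) y0 = y"
  shows "i \<le> n" "iroot n i y < 0" "ascending n w y0" "fold (irefl n) w y0 = irefl n i y"
  using assms by (auto simp: ascending_append iroot_irefl irefl_invol)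

text \<open>Matsumoto's theorem for ascending words, by an induction in the style of Newman's lemma.
  Equal last letters are stripped; otherwise both words are compared with words passing through the
  bottom of the diamond.\<close>

lemma ascending_words_coxeq:
  assumes n: "n \<ge> 2"
    and "y \<in> regular_pts n" "ascending n u (base_pt n)" "ascending n v (base_pt n)"
    and "fold (irefl n) u (base_pt n) = y" "fold (irefl n) v (base_pt n) = y"
  shows "coxeq n u v"
  using assms(2-)
proof (induction "base_dist n y" arbitrary: y u v rule: less_induct)
  case less
  have noneg: "\<not> iroot n i (base_pt n) < 0" if "i \<le> n" for i
    using that by (auto simp: iroot_def base_pt_def)
  \<comment> \<open>A nonempty ascending word ends in a descent of its endpoint, and the base point
    has no descents.\<close>
  have empty: "w = []" if "ascending n w (base_pt n)" "fold (irefl n) w (base_pt n) = base_pt n" for w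
    using ascending_snocD[OF n, of "butlast w" "last w" "base_pt n" "base_pt n"] that noneg
    by (cases "w = []") auto
  show ?case
  proof (cases "u = [] \<or> v = []")
    case True
    then have "u = [] \<and> v = []" using less.prems empty by auto
    then show ?thesis by (simp add: coxeq.refl)
  next
    case False
    then obtain u' i v' j where uv: "u = u' @ [i]" "v = v' @ [j]" by (metis append_butlast_last_id)
    note U = ascending_snocD[OF n less.prems(2)[unfolded uv] less.prems(4)[unfolded uv]]
    note V = ascending_snocD[OF n less.prems(3)[unfolded uv] less.prems(5)[unfolded uv]]
    have IH: "coxeq n (w @ [k]) (w' @ [k])" if "k \<le> n" "iroot n k y < 0"
      "ascending n w (base_pt n)" "fold (irefl n) w (base_pt n) = irefl n k y"
      "ascending n w' (base_pt n)" "fold (irefl n) w' (base_pt n) = irefl n k y" for w w' k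
      using coxeq.ctxt[of "[]" n "[k]", OF _ _ less.hyps[OF base_dist_irefl[OF n that(1,2)]
        irefl_regular[OF n that(1) less.prems(1)] that(3,5,4,6)]] that(1) by simp
    have main: "coxeq n (u' @ [i]) (v' @ [j])"
      if h: "i < j" "i \<le> n" "j \<le> n" "iroot n i y < 0" "iroot n j y < 0"
       "ascending n u' (base_pt n)" "fold (irefl n) u' (base_pt n) = irefl n i y"
       "ascending n v' (base_pt n)" "fold (irefl n) v' (base_pt n) = irefl n j y" for u' v' i j
    proof -
      obtain s s' where s: "ascending n (rev (i # s)) (fold (irefl n) (i # s) y)"
        "ascending n (rev (j # s')) (fold (irefl n) (j # s') y)"
        "fold (irefl n) (i # s) y = fold (irefl n) (j # s') y" "coxeq n (rev (i # s)) (rev (j # s'))"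
        using descents_diamond[OF n h(1,3,4,5)] by blast
      \<comment> \<open>The bottom of the diamond. An ascending word \<open>w\<close> to
        \<open>z\<close>, prolonged by \<open>rev s\<close> or \<open>rev s'\<close>, reaches the
        two reflections of \<open>y\<close>, where the induction hypothesis compares it with
        \<open>u'\<close> and \<open>v'\<close>.\<close>
      define z where "z = fold (irefl n) (i # s) y"
      have set: "set (i # s) \<subseteq> {0..n}" using ascending_set[OF s(1)] by simp
      have "z \<in> regular_pts n" unfolding z_def by (rule fold_irefl_regular[OF n set less.prems(1)])
      then obtain w where w: "ascending n w (base_pt n)" "fold (irefl n) w (base_pt n) = z"
        using ascending_word_exists[OF n] by blast
      have "ascending n (w @ rev s) (base_pt n)" "fold (irefl n) (w @ rev s) (base_pt n) = irefl n i y"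
        using w s(1) fold_irefl_rev[of n s "irefl n i y"] unfolding z_def[symmetric]
        by (auto simp: ascending_append z_def)
      from IH[OF h(2,4,6,7) this]
      have 1: "coxeq n (u' @ [i]) (w @ rev (i # s))" by simp
      have "ascending n (w @ rev s') (base_pt n)" "fold (irefl n) (w @ rev s') (base_pt n) = irefl n j y"
        using w s(2) fold_irefl_rev[of n s' "irefl n j y"] unfolding s(3)[symmetric] z_def[symmetric]
        by (auto simp: ascending_append z_def s(3)[simplified])
      from IH[OF h(3,5,8,9) this]
      have 2: "coxeq n (v' @ [j]) (w @ rev (j # s'))" by simp
      have "coxeq n (w @ rev (i # s)) (w @ rev (j # s'))"
        using coxeq.ctxt[OF ascending_set[OF w(1)] _ s(4), of "[]"] by simp
      with 1 2 show ?thesis by (meson coxeq.sym coxeq.trans)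
    qed
    consider "i = j" | "i < j" | "j < i" by linarith
    then show ?thesis
    proof cases
      case 1 then show ?thesis using IH U V uv by auto
    next
      case 2 then show ?thesis using main[OF 2] U V uv by auto
    next
      case 3 then show ?thesis using coxeq.sym[OF main[OF 3]] U V uv by auto
    qed
  qed
qed

text \<open>Adding letters one at a time, an equivalent ascending word is maintained: an ascending
  letter is appended; for a descending letter the current word is exchanged for an ascending one
  ending in that letter, which then cancels by \<open>invol\<close>.\<close>

theorem coxeq_if_same_point:
  assumes n: "n \<ge> 2" and "set u \<subseteq> {0..n}" "set v \<subseteq> {0..n}"
    and eq: "fold (irefl n) u (base_pt n) = fold (irefl n) v (base_pt n)"
  shows "coxeq n u v"
proof -
  have asc: "\<exists>w'. ascending n w' (base_pt n) \<and> fold (irefl n) w' (base_pt n) = fold (irefl n) w (base_pt n) \<and> coxeq n w w'"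
    if "set w \<subseteq> {0..n}" for w
    using that
  proof (induction w rule: rev_induct)
    case Nil show ?case by (intro exI[of _ "[]"]) (auto intro: coxeq.refl)
  next
    case (snoc i w)
    let ?y = "fold (irefl n) w (base_pt n)"
    obtain w' where w': "ascending n w' (base_pt n)" "fold (irefl n) w' (base_pt n) = ?y" "coxeq n w w'"
      using snoc by auto
    have i: "i \<le> n" and reg: "?y \<in> regular_pts n"
      using snoc.prems fold_irefl_regular[OF n _ base_pt_regular] by auto
    have step: "coxeq n (a @ [i]) (b @ [i])" if "coxeq n a b" for a b
      using coxeq.ctxt[of "[]" n "[i]", OF _ _ that] i by simp
    show ?case
    proof (cases "iroot n i ?y > 0")
      case True
      then show ?thesis using w' i step[OF w'(3)] by (intro exI[of _ "w' @ [i]"]) (auto simp: ascending_append)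
    next
      case False
      then have neg: "iroot n i ?y < 0" using regular_pts_iroot[OF n i reg] by simp
      obtain v where v: "ascending n v (base_pt n)" "fold (irefl n) v (base_pt n) = irefl n i ?y"
        using ascending_word_exists[OF n irefl_regular[OF n i reg]] by blast
      have "ascending n (v @ [i]) (base_pt n)" "fold (irefl n) (v @ [i]) (base_pt n) = ?y"
        using v neg i n by (auto simp: ascending_append iroot_irefl irefl_invol)
      with w' have "coxeq n w' (v @ [i])" using ascending_words_coxeq[OF n reg] by blast
      then have "coxeq n (w @ [i]) ((v @ [i]) @ [i])" using w'(3) step coxeq.trans by blast
      moreover have "coxeq n (v @ [i, i]) v"
        using coxeq.ctxt[of v n "[]", OF _ _ coxeq.invol[OF i]] ascending_set[OF v(1)] by simp
      ultimately have "coxeq n (w @ [i]) v" by (auto intro: coxeq.trans)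
      then show ?thesis using v by auto
    qed
  qed
  show ?thesis
    using asc[OF assms(2)] asc[OF assms(3)] eq ascending_words_coxeq[OF n fold_irefl_regular[OF n assms(2) base_pt_regular]]
    by (metis coxeq.sym coxeq.trans)
qed

section \<open>Faithfulness for the trigonometric algebra\<close>

fun gen_op :: "nat \<Rightarrow> daha_params \<Rightarrow> gen \<Rightarrow> cfun \<Rightarrow> cfun" where
  "gen_op n t (Refl i) p = dunkl n t i p"
| "gen_op n t (Pol q) p = (\<lambda>x. q x * p x)"

text \<open>\<open>foldr\<close> makes concatenation of words composition of operators. On the
  argument of a function the letters then act from left to right, which matches
  \<open>fold (refl_pt n)\<close>.\<close>

definition word_op :: "nat \<Rightarrow> daha_params \<Rightarrow> gen list \<Rightarrow> cfun \<Rightarrow> cfun" where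
  "word_op n t w p = foldr (gen_op n t) w p"

definition free_op :: "nat \<Rightarrow> daha_params \<Rightarrow> free \<Rightarrow> cfun \<Rightarrow> cfun" where
  "free_op n t a p = (\<lambda>x. \<Sum>w\<in>Poly_Mapping.keys a. Poly_Mapping.lookup a w * word_op n t w p x)"

section \<open>The free algebra and its action on polynomials\<close>

lemma poly_mapping_sum_singles:
  "a = (\<Sum>w\<in>Poly_Mapping.keys a. Poly_Mapping.single w (Poly_Mapping.lookup a w))"
  by (rule poly_mapping_eqI) (auto simp: lookup_sum lookup_single when_def in_keys_iff)

lemma free_op_superset:
  assumes "finite F" "Poly_Mapping.keys a \<subseteq> F"
  shows "free_op n t a p x = (\<Sum>w\<in>F. Poly_Mapping.lookup a w * word_op n t w p x)"
  unfolding free_op_def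
  by (rule sum.mono_neutral_left) (use assms in \<open>auto simp: in_keys_iff\<close>)

lemma free_op_zero: "free_op n t 0 p = (\<lambda>x. 0)"
  by (simp add: free_op_def)

lemma free_op_single: "free_op n t (Poly_Mapping.single w c) p = (\<lambda>x. c * word_op n t w p x)"
  by (auto simp: free_op_superset[of "{w}"])

lemma free_op_add: "free_op n t (a + b) p = (\<lambda>x. free_op n t a p x + free_op n t b p x)"
proof
  fix x
  let ?F = "Poly_Mapping.keys a \<union> Poly_Mapping.keys b"
  have "Poly_Mapping.keys (a + b) \<subseteq> ?F" by (rule keys_add)
  then show "free_op n t (a + b) p x = free_op n t a p x + free_op n t b p x"
    by (simp add: free_op_superset[of ?F] lookup_add algebra_simps sum.distrib)
qed

lemma free_op_uminus: "free_op n t (- a) p = (\<lambda>x. - free_op n t a p x)"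
  by (auto simp: free_op_def keys_def sum_negf)

lemma free_op_diff: "free_op n t (a - b) p = (\<lambda>x. free_op n t a p x - free_op n t b p x)"
  using free_op_add[of n t a "- b" p] by (simp add: free_op_uminus)

lemma free_op_sum: "free_op n t (sum f F) p = (\<lambda>x. \<Sum>i\<in>F. free_op n t (f i) p x)"
  by (induction F rule: infinite_finite_induct) (auto simp: free_op_zero free_op_add)

lemma free_alg_carrier:
  "a \<in> carrier (free_alg n) \<longleftrightarrow> (\<forall>w\<in>Poly_Mapping.keys a. set w \<subseteq> gens n)"
  by (simp add: free_alg_def)

lemma free_alg_ops [simp]:
  "monoid.mult (free_alg n) = (*)" "one (free_alg n) = 1" "zero (free_alg n) = 0" "add (free_alg n) = (+)"
  by (simp_all add: free_alg_def)

lemma free_alg_zero_in: "0 \<in> carrier (free_alg n)"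
  by (simp add: free_alg_carrier)

lemma free_alg_one_in: "1 \<in> carrier (free_alg n)"
  by (simp add: free_alg_carrier zero_list_def)

lemma free_alg_add_in:
  "a \<in> carrier (free_alg n) \<Longrightarrow> b \<in> carrier (free_alg n) \<Longrightarrow> a + b \<in> carrier (free_alg n)"
  unfolding free_alg_carrier using keys_add[of a b] by blast

lemma free_alg_uminus_in: "a \<in> carrier (free_alg n) \<Longrightarrow> - a \<in> carrier (free_alg n)"
  unfolding free_alg_carrier by (simp add: in_keys_iff)

lemma free_alg_diff_in:
  "a \<in> carrier (free_alg n) \<Longrightarrow> b \<in> carrier (free_alg n) \<Longrightarrow> a - b \<in> carrier (free_alg n)"
  using free_alg_add_in[OF _ free_alg_uminus_in] by simp

lemma free_alg_mult_in:
  assumes "a \<in> carrier (free_alg n)" "b \<in> carrier (free_alg n)"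
  shows "a * b \<in> carrier (free_alg n)"
  using assms keys_mult[of a b] unfolding free_alg_carrier plus_list_def by fastforce

lemma free_alg_sum_in: "(\<And>i. i \<in> F \<Longrightarrow> f i \<in> carrier (free_alg n)) \<Longrightarrow> sum f F \<in> carrier (free_alg n)"
  by (induction F rule: infinite_finite_induct) (auto intro: free_alg_zero_in free_alg_add_in)

lemma fR_in: "i \<le> n \<Longrightarrow> fR i \<in> carrier (free_alg n)"
  by (auto simp: free_alg_carrier fR_def gens_def)

lemma fP_in: "p \<in> polys n \<Longrightarrow> fP p \<in> carrier (free_alg n)"
  by (auto simp: free_alg_carrier fP_def gens_def)

lemma fC_in: "fC c \<in> carrier (free_alg n)"
  by (auto simp: free_alg_carrier fC_def)

lemmas free_alg_in = free_alg_zero_in free_alg_one_in free_alg_add_in free_alg_uminus_in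
  free_alg_diff_in free_alg_mult_in free_alg_sum_in fR_in fP_in fC_in

lemma ring_free_alg: "ring (free_alg n)"
proof (intro ringI abelian_groupI monoidI)
  show "\<exists>y\<in>carrier (free_alg n). y \<oplus>\<^bsub>free_alg n\<^esub> x = \<zero>\<^bsub>free_alg n\<^esub>" if "x \<in> carrier (free_alg n)" for x
    using that by (intro bexI[of _ "- x"]) (auto intro: free_alg_in)
qed (auto intro: free_alg_in simp: algebra_simps)

lemma free_alg_a_inv: "a \<in> carrier (free_alg n) \<Longrightarrow> \<ominus>\<^bsub>free_alg n\<^esub> a = - a"
  by (rule abelian_group.minus_equality[OF ring.is_abelian_group[OF ring_free_alg]])
    (auto intro: free_alg_in)

abbreviation "rel_ideal n t \<equiv> Idl\<^bsub>free_alg n\<^esub> (relators n t)"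

definition refl_word :: "nat list \<Rightarrow> free" where
  "refl_word w = prod_list (map fR w)"

lemma refl_word_in: "set w \<subseteq> {0..n} \<Longrightarrow> refl_word w \<in> carrier (free_alg n)"
  unfolding refl_word_def by (induction w) (auto intro: free_alg_in)

lemma refl_word_append: "refl_word (u @ v) = refl_word u * refl_word v"
  by (simp add: refl_word_def)

context
  fixes n :: nat and t :: daha_params
  assumes n: "n \<ge> 2"
begin

lemma gen_op_polys: "g \<in> gens n \<Longrightarrow> p \<in> polys n \<Longrightarrow> gen_op n t g p \<in> polys n"
  using n by (auto simp: gens_def intro: dunkl_polys polys.mult)

lemma word_op_polys: "set w \<subseteq> gens n \<Longrightarrow> p \<in> polys n \<Longrightarrow> word_op n t w p \<in> polys n"
  unfolding word_op_def by (induction w) (auto intro: gen_op_polys)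

lemma gen_op_add:
  "g \<in> gens n \<Longrightarrow> p \<in> polys n \<Longrightarrow> q \<in> polys n \<Longrightarrow>
    gen_op n t g (\<lambda>x. p x + q x) = (\<lambda>x. gen_op n t g p x + gen_op n t g q x)"
  using n by (auto simp: gens_def dunkl_add algebra_simps)

lemma gen_op_scale:
  "g \<in> gens n \<Longrightarrow> p \<in> polys n \<Longrightarrow> gen_op n t g (\<lambda>x. c * p x) = (\<lambda>x. c * gen_op n t g p x)"
  using n by (auto simp: gens_def dunkl_scale algebra_simps)

lemma word_op_add:
  assumes "set w \<subseteq> gens n" "p \<in> polys n" "q \<in> polys n"
  shows "word_op n t w (\<lambda>x. p x + q x) = (\<lambda>x. word_op n t w p x + word_op n t w q x)"
  using assms(1)
proof (induction w)
  case (Cons g w)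
  then show ?case using gen_op_add[of g "word_op n t w p" "word_op n t w q"] word_op_polys assms
    by (simp add: word_op_def)
qed (simp add: word_op_def)

lemma word_op_scale:
  assumes "set w \<subseteq> gens n" "p \<in> polys n"
  shows "word_op n t w (\<lambda>x. c * p x) = (\<lambda>x. c * word_op n t w p x)"
  using assms(1)
proof (induction w)
  case (Cons g w)
  then show ?case using gen_op_scale[of g "word_op n t w p"] word_op_polys assms
    by (simp add: word_op_def)
qed (simp add: word_op_def)

lemma word_op_sum:
  assumes "finite F" "set w \<subseteq> gens n" "\<And>i. i \<in> F \<Longrightarrow> f i \<in> polys n"
  shows "word_op n t w (\<lambda>x. \<Sum>i\<in>F. f i x) = (\<lambda>x. \<Sum>i\<in>F. word_op n t w (f i) x)"
  using assms(1,3)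
proof (induction F rule: finite_induct)
  case empty
  then show ?case using word_op_scale[OF assms(2) polys.const, of 0 0] by simp
next
  case (insert i F)
  then show ?case using word_op_add[OF assms(2), of "f i" "\<lambda>x. \<Sum>i\<in>F. f i x"] polys_sum[of F f n] by simp
qed

lemma free_op_polys: "a \<in> carrier (free_alg n) \<Longrightarrow> p \<in> polys n \<Longrightarrow> free_op n t a p \<in> polys n"
  unfolding free_op_def by (intro polys_sum polys.mult polys.const word_op_polys) (auto simp: free_alg_carrier)

lemma free_op_add_arg:
  assumes "a \<in> carrier (free_alg n)" "p \<in> polys n" "q \<in> polys n"
  shows "free_op n t a (\<lambda>x. p x + q x) = (\<lambda>x. free_op n t a p x + free_op n t a q x)"
  using assms by (auto simp: free_op_def free_alg_carrier word_op_add sum.distrib algebra_simps)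

lemma free_op_scale_arg:
  assumes "a \<in> carrier (free_alg n)" "p \<in> polys n"
  shows "free_op n t a (\<lambda>x. c * p x) = (\<lambda>x. c * free_op n t a p x)"
  using assms by (auto simp: free_op_def free_alg_carrier word_op_scale sum_distrib_left algebra_simps)

lemma free_op_mult:
  assumes a: "a \<in> carrier (free_alg n)" and b: "b \<in> carrier (free_alg n)" and p: "p \<in> polys n"
  shows "free_op n t (a * b) p = free_op n t a (free_op n t b p)"
proof -
  have w: "set w \<subseteq> gens n" if "w \<in> Poly_Mapping.keys a \<or> w \<in> Poly_Mapping.keys b" for w
    using that a b by (auto simp: free_alg_carrier)
  have "a * b = (\<Sum>u\<in>Poly_Mapping.keys a. Poly_Mapping.single u (Poly_Mapping.lookup a u)) *
     (\<Sum>v\<in>Poly_Mapping.keys b. Poly_Mapping.single v (Poly_Mapping.lookup b v))"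
    by (simp flip: poly_mapping_sum_singles)
  also have "\<dots> = (\<Sum>u\<in>Poly_Mapping.keys a. \<Sum>v\<in>Poly_Mapping.keys b.
      Poly_Mapping.single (u @ v) (Poly_Mapping.lookup a u * Poly_Mapping.lookup b v))"
    by (simp add: sum_product mult_single plus_list_def)
  finally have "free_op n t (a * b) p = (\<lambda>x. \<Sum>u\<in>Poly_Mapping.keys a. \<Sum>v\<in>Poly_Mapping.keys b.
      (Poly_Mapping.lookup a u * Poly_Mapping.lookup b v) * word_op n t (u @ v) p x)"
    by (simp add: free_op_sum free_op_single)
  also have "\<dots> = (\<lambda>x. \<Sum>u\<in>Poly_Mapping.keys a. Poly_Mapping.lookup a u * word_op n t u (free_op n t b p) x)"
  proof (rule ext, rule sum.cong)
    fix x u assume "u \<in> Poly_Mapping.keys a"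
    then have "word_op n t u (free_op n t b p) =
       (\<lambda>x. \<Sum>v\<in>Poly_Mapping.keys b. Poly_Mapping.lookup b v * word_op n t u (word_op n t v p) x)"
      unfolding free_op_def using w p
      by (subst word_op_sum) (auto simp: word_op_scale word_op_polys intro!: polys.mult polys.const word_op_polys)
    then show "(\<Sum>v\<in>Poly_Mapping.keys b. (Poly_Mapping.lookup a u * Poly_Mapping.lookup b v) * word_op n t (u @ v) p x) =
       Poly_Mapping.lookup a u * word_op n t u (free_op n t b p) x"
      by (simp add: word_op_def sum_distrib_left mult.assoc)
  qed simp
  finally show ?thesis by (simp add: free_op_def)
qed

lemma free_op_one: "free_op n t 1 p = p"
proof -
  have *: "(1 :: free) = Poly_Mapping.single [] 1" by (metis single_one zero_list_def)
  show ?thesis unfolding * free_op_single by (simp add: word_op_def)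
qed

lemma free_op_fR: "free_op n t (fR i) p = dunkl n t i p"
  by (simp add: fR_def free_op_single word_op_def)

lemma free_op_fP: "free_op n t (fP q) p = (\<lambda>x. q x * p x)"
  by (simp add: fP_def free_op_single word_op_def)

lemma free_op_fC: "free_op n t (fC c) p = (\<lambda>x. c * p x)"
  by (simp add: fC_def free_op_single word_op_def)

lemmas free_op_simps = free_op_zero free_op_add free_op_uminus free_op_diff free_op_mult free_op_one
  free_op_fR free_op_fP free_op_fC

section \<open>Descent of the action to the quotient by the relations\<close>

lemma relators_in: "relators n t \<subseteq> carrier (free_alg n)"
proof
  fix a assume "a \<in> relators n t"
  then show "a \<in> carrier (free_alg n)"
    by cases (use n in \<open>auto intro!: free_alg_in polys_refl_act polys.intros\<close>)
qed

lemma relators_act_trivially: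
  assumes "a \<in> relators n t" "p \<in> polys n"
  shows "free_op n t a p = (\<lambda>x. 0)"
  using assms(1)
proof cases
  case (invol i)
  then show ?thesis using n assms(2) by (simp add: free_op_simps free_alg_in dunkl_invol)
next
  case (braid4 i)
  have "dunkl n t i (dunkl n t (i + 1) (dunkl n t i (dunkl n t (i + 1) p))) =
     dunkl n t (i + 1) (dunkl n t i (dunkl n t (i + 1) (dunkl n t i p)))"
    using braid4(2)
  proof (elim insertE emptyE)
    assume "i = 0"
    then show ?thesis using n assms(2)
      by (intro dunkl_braid4) (auto simp: aroot_def refl_pt_def fun_eq_iff)
  next
    \<comment> \<open>At this end the long root is \<open>aroot n n\<close>, which belongs to the
      second letter, so the roles in \<open>dunkl_braid4\<close> are exchanged.\<close>
    assume "i = n - 1"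
    then show ?thesis using n assms(2)
      by (intro dunkl_braid4[symmetric]) (auto simp: aroot_def refl_pt_def fun_eq_iff)
  qed
  moreover have "i + 1 \<le> n" using braid4 n by auto
  ultimately show ?thesis using braid4 n assms(2)
    by (simp add: free_op_simps free_alg_in dunkl_polys)
next
  case (braid3 i)
  have "dunkl n t i (dunkl n t (i + 1) (dunkl n t i p)) = dunkl n t (i + 1) (dunkl n t i (dunkl n t (i + 1) p))"
    using n assms(2) braid3
    by (intro dunkl_braid3) (auto simp: aroot_def kpar_def refl_pt_def fun_eq_iff)
  then show ?thesis using braid3 n assms(2)
    by (simp add: free_op_simps free_alg_in dunkl_polys)
next
  case (commute i j)
  have "dunkl n t i (dunkl n t j p) = dunkl n t j (dunkl n t i p)"
    using n assms(2) commute
    by (intro dunkl_commute) (auto simp: aroot_def refl_pt_def fun_eq_iff)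
  then show ?thesis using commute n assms(2)
    by (simp add: free_op_simps free_alg_in dunkl_polys)
next
  case (pol_const c)
  then show ?thesis using assms(2) by (simp add: free_op_simps free_alg_in polys.const)
next
  case (pol_add r q)
  show ?thesis unfolding pol_add(1) using pol_add(2,3) assms(2)
    by (simp add: free_op_simps free_alg_in polys.add algebra_simps)
next
  case (pol_mult r q)
  show ?thesis unfolding pol_mult(1) using pol_mult(2,3) assms(2)
    by (simp add: free_op_simps free_alg_in polys.mult algebra_simps)
next
  case (cross i r q)
  have "dunkl n t i (\<lambda>x. r x * p x) = (\<lambda>x. refl_act n i r x * dunkl n t i p x + q x * p x)"
  proof (rule polys_eqI_aroot[OF n _ _ cross(2)])
    fix x assume x: "aroot n i x \<noteq> 0"
    have q: "q x = kpar n t i * (r (refl_pt n i x) - r x) / aroot n i x"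
      using spec[OF cross(5), of x] x by (simp add: nonzero_eq_divide_eq refl_act_def mult.commute)
    show "dunkl n t i (\<lambda>x. r x * p x) x = refl_act n i r x * dunkl n t i p x + q x * p x"
      unfolding q dunkl_eq[OF n cross(2) assms(2) x] dunkl_eq[OF n cross(2) polys.mult[OF cross(3) assms(2)] x] refl_act_def
      by (simp add: algebra_simps diff_divide_distrib)
  qed (use n cross assms(2) in \<open>auto intro!: dunkl_polys polys.add polys.mult polys_refl_act\<close>)
  then show ?thesis using cross n assms(2)
    by (simp add: free_op_simps free_alg_in dunkl_polys polys.mult polys_refl_act)
qed

lemma rel_ideal_ideal: "ideal (rel_ideal n t) (free_alg n)"
  by (rule ring.genideal_ideal[OF ring_free_alg relators_in])

lemma rel_ideal_in: "a \<in> rel_ideal n t \<Longrightarrow> a \<in> carrier (free_alg n)"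
  by (rule additive_subgroup.a_Hcarr[OF ideal.axioms(1)[OF rel_ideal_ideal]])

lemma relators_rel_ideal: "a \<in> relators n t \<Longrightarrow> a \<in> rel_ideal n t"
  using ring.genideal_self[OF ring_free_alg relators_in] by blast

text \<open>The elements that annihilate all polynomials form a two-sided ideal \<open>?J\<close>,
  so it is enough that it contains the relators.\<close>

lemma rel_ideal_acts_trivially:
  assumes "a \<in> rel_ideal n t" "p \<in> polys n"
  shows "free_op n t a p = (\<lambda>x. 0)"
proof -
  let ?J = "{a \<in> carrier (free_alg n). \<forall>p\<in>polys n. free_op n t a p = (\<lambda>x. 0)}"
  have zero: "free_op n t a (\<lambda>x. 0) = (\<lambda>x. 0)" if "a \<in> carrier (free_alg n)" for a
    using free_op_scale_arg[OF that polys.const, of 0 0] by simp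
  have "ideal ?J (free_alg n)"
  proof (rule idealI[OF ring_free_alg])
    show "subgroup ?J (add_monoid (free_alg n))"
    proof (rule group.subgroupI[OF abelian_group.a_group[OF ring.is_abelian_group[OF ring_free_alg]]])
      fix a assume "a \<in> ?J"
      moreover from this have "inv\<^bsub>add_monoid (free_alg n)\<^esub> a = - a"
        using free_alg_a_inv[of a n] by (simp add: a_inv_def)
      ultimately show "inv\<^bsub>add_monoid (free_alg n)\<^esub> a \<in> ?J" by (auto simp: free_op_simps intro: free_alg_in)
    qed (use free_op_zero free_alg_zero_in in \<open>auto simp: free_op_simps intro: free_alg_in\<close>)
  qed (auto simp: free_op_simps zero free_op_polys intro: free_alg_in)
  moreover have "relators n t \<subseteq> ?J" using relators_in relators_act_trivially by auto
  ultimately have "rel_ideal n t \<subseteq> ?J" by (rule ring.genideal_minimal[OF ring_free_alg])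
  then show ?thesis using assms by auto
qed

lemma rel_ideal_zero: "0 \<in> rel_ideal n t"
  using additive_subgroup.zero_closed[OF ideal.axioms(1)[OF rel_ideal_ideal]] by simp

lemma rel_ideal_add: "a \<in> rel_ideal n t \<Longrightarrow> b \<in> rel_ideal n t \<Longrightarrow> a + b \<in> rel_ideal n t"
  using additive_subgroup.a_closed[OF ideal.axioms(1)[OF rel_ideal_ideal]] by simp

lemma rel_ideal_uminus: "a \<in> rel_ideal n t \<Longrightarrow> - a \<in> rel_ideal n t"
  using additive_subgroup.a_inv_closed[OF ideal.axioms(1)[OF rel_ideal_ideal]] free_alg_a_inv rel_ideal_in by metis

lemma rel_ideal_lmult: "a \<in> rel_ideal n t \<Longrightarrow> c \<in> carrier (free_alg n) \<Longrightarrow> c * a \<in> rel_ideal n t"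
  using ideal.I_l_closed[OF rel_ideal_ideal] by simp

lemma rel_ideal_rmult: "a \<in> rel_ideal n t \<Longrightarrow> c \<in> carrier (free_alg n) \<Longrightarrow> a * c \<in> rel_ideal n t"
  using ideal.I_r_closed[OF rel_ideal_ideal] by simp

lemma coxeq_rel_ideal: "coxeq n u v \<Longrightarrow> refl_word u - refl_word v \<in> rel_ideal n t"
proof (induction rule: coxeq.induct)
  case (refl u) show ?case by (simp add: rel_ideal_zero)
next
  case (sym u v) then show ?case using rel_ideal_uminus by fastforce
next
  case (trans u v w) then show ?case using rel_ideal_add by fastforce
next
  case (ctxt a b u v)
  then have "refl_word a * (refl_word u - refl_word v) * refl_word b \<in> rel_ideal n t"
    by (intro rel_ideal_lmult rel_ideal_rmult refl_word_in)
  then show ?case by (simp add: refl_word_append algebra_simps)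
next
  case (invol i) then show ?case using relators.invol[of i n t] by (auto simp: refl_word_def intro: relators_rel_ideal)
next
  case (braid4 i) then show ?case using relators.braid4[of i n t] by (auto simp: refl_word_def mult.assoc intro: relators_rel_ideal)
next
  case (braid3 i) then show ?case using relators.braid3[of i n t] by (auto simp: refl_word_def mult.assoc intro: relators_rel_ideal)
next
  case (commute i j) then show ?case using relators.commute[of i n j t] by (auto simp: refl_word_def intro: relators_rel_ideal)
qed

definition eqv :: "free \<Rightarrow> free \<Rightarrow> bool" (infix "\<approx>" 50) where
  "a \<approx> b \<longleftrightarrow> a \<in> carrier (free_alg n) \<and> b \<in> carrier (free_alg n) \<and> a - b \<in> rel_ideal n t"

lemma eqv_refl: "a \<in> carrier (free_alg n) \<Longrightarrow> a \<approx> a"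
  by (simp add: eqv_def rel_ideal_zero)

lemma eqv_sym: "a \<approx> b \<Longrightarrow> b \<approx> a"
  unfolding eqv_def using rel_ideal_uminus[of "a - b"] by simp

lemma eqv_trans [trans]: "a \<approx> b \<Longrightarrow> b \<approx> c \<Longrightarrow> a \<approx> c"
  unfolding eqv_def using rel_ideal_add[of "a - b" "b - c"] by simp

lemma eqv_add: "a \<approx> b \<Longrightarrow> c \<approx> d \<Longrightarrow> a + c \<approx> b + d"
  unfolding eqv_def using rel_ideal_add[of "a - b" "c - d"] by (auto simp: algebra_simps intro: free_alg_in)

lemma eqv_mult: assumes "a \<approx> b" "c \<approx> d" shows "a * c \<approx> b * d"
proof -
  have "(a - b) * c + b * (c - d) \<in> rel_ideal n t"
    using assms unfolding eqv_def by (intro rel_ideal_add rel_ideal_lmult rel_ideal_rmult) auto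
  then show ?thesis using assms unfolding eqv_def by (auto simp: algebra_simps intro: free_alg_in)
qed

lemma eqv_sum: "(\<And>i. i \<in> F \<Longrightarrow> f i \<approx> g i) \<Longrightarrow> sum f F \<approx> sum g F"
  by (induction F rule: infinite_finite_induct) (auto intro: eqv_add eqv_refl free_alg_in)

lemma eqvI: "a - b \<in> relators n t \<Longrightarrow> a \<in> carrier (free_alg n) \<Longrightarrow> b \<in> carrier (free_alg n) \<Longrightarrow> a \<approx> b"
  unfolding eqv_def by (auto intro: relators_rel_ideal)

lemma eqv_cross:
  assumes "i \<le> n" "p \<in> polys n"
  shows "fR i * fP p \<approx> fP (refl_act n i p) * fR i + fP (\<lambda>x. kpar n t i * divided_difference n i p x)"
proof -
  have q: "(\<lambda>x. kpar n t i * divided_difference n i p x) \<in> polys n"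
    using n assms by (intro polys.intros divided_difference)
  have "(fR i * fP p - fP (refl_act n i p) * fR i) - fP (\<lambda>x. kpar n t i * divided_difference n i p x) \<in> relators n t"
  proof (intro relators.cross assms q allI)
    show "aroot n i x * (kpar n t i * divided_difference n i p x) = kpar n t i * (refl_act n i p x - p x)" for x
      by (subst mult.left_commute) (simp only: divided_difference(2)[OF n assms])
  qed
  then show ?thesis using assms q n
    by (intro eqvI) (auto simp: algebra_simps intro!: free_alg_in polys_refl_act)
qed

lemma eqv_fP_zero: "fP (\<lambda>x. 0) \<approx> 0"
  using relators.pol_const[of 0 n t]
  by (intro eqvI) (auto simp: fC_def intro!: free_alg_in polys.const)

lemma eqv_fP_const: "fP (\<lambda>x. c) \<approx> fC c"
  using relators.pol_const[of c n t] by (intro eqvI) (auto intro!: free_alg_in polys.const)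

lemma eqv_fP_add: "p \<in> polys n \<Longrightarrow> q \<in> polys n \<Longrightarrow> fP (\<lambda>x. p x + q x) \<approx> fP p + fP q"
  by (intro eqvI relators.pol_add) (auto intro!: free_alg_in polys.add)

lemma eqv_fP_mult: "p \<in> polys n \<Longrightarrow> q \<in> polys n \<Longrightarrow> fP (\<lambda>x. p x * q x) \<approx> fP p * fP q"
  by (intro eqvI relators.pol_mult) (auto intro!: free_alg_in polys.mult)

section \<open>Spanning by the products \<open>p(X) r_w\<close>\<close>

definition is_word :: "(nat \<Rightarrow> int) \<Rightarrow> nat list \<Rightarrow> bool" where
  "is_word y w \<longleftrightarrow> set w \<subseteq> {0..n} \<and> fold (irefl n) w (base_pt n) = y"

text \<open>A group element is encoded by the image \<open>y\<close> of the base point, and this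
  picks a reduced word for it. Minimality of the length later guarantees that shorter words
  represent other elements.\<close>

definition min_word :: "(nat \<Rightarrow> int) \<Rightarrow> nat list" where
  "min_word y = arg_min length (is_word y)"

lemma min_word:
  assumes "is_word y w" shows "is_word y (min_word y)" "length (min_word y) \<le> length w"
  unfolding min_word_def using arg_min_nat_lemma[of "is_word y" w length] assms by auto

lemma is_word_eqv: "is_word y u \<Longrightarrow> is_word y v \<Longrightarrow> refl_word u \<approx> refl_word v"
  unfolding is_word_def eqv_def by (auto intro!: refl_word_in coxeq_rel_ideal coxeq_if_same_point[OF n])

text \<open>The spanning half of the Poincare-Birkhoff-Witt property. Coefficients stand on the
  left, where they act by multiplication and can be evaluated at a point.\<close>

definition spanned :: "free set" where
  "spanned = {a. \<exists>F p. finite F \<and> (\<forall>y\<in>F. \<exists>w. is_word y w) \<and> (\<forall>y. p y \<in> polys n) \<and>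
     a \<approx> (\<Sum>y\<in>F. fP (p y) * refl_word (min_word y))}"

lemma min_word_in: "is_word y w \<Longrightarrow> refl_word (min_word y) \<in> carrier (free_alg n)"
  using min_word(1) by (auto simp: is_word_def intro: refl_word_in)

lemma spanned_cong: "a \<approx> b \<Longrightarrow> b \<in> spanned \<Longrightarrow> a \<in> spanned"
  unfolding spanned_def using eqv_trans by blast

lemma spanned_add:
  assumes "a \<in> spanned" "b \<in> spanned" shows "a + b \<in> spanned"
proof -
  obtain F p where F: "finite F" "\<And>y. y \<in> F \<Longrightarrow> \<exists>w. is_word y w" "\<And>y. p y \<in> polys n"
    "a \<approx> (\<Sum>y\<in>F. fP (p y) * refl_word (min_word y))" using assms(1) unfolding spanned_def by blast
  obtain G q where G: "finite G" "\<And>y. y \<in> G \<Longrightarrow> \<exists>w. is_word y w" "\<And>y. q y \<in> polys n"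
    "b \<approx> (\<Sum>y\<in>G. fP (q y) * refl_word (min_word y))" using assms(2) unfolding spanned_def by blast
  define p' q' where "p' = (\<lambda>y. if y \<in> F then p y else (\<lambda>x. 0))" and "q' = (\<lambda>y. if y \<in> G then q y else (\<lambda>x. 0))"
  have pq: "p' y \<in> polys n" "q' y \<in> polys n" for y unfolding p'_def q'_def using F G by (auto intro: polys.const)
  have R: "refl_word (min_word y) \<in> carrier (free_alg n)" if "y \<in> F \<union> G" for y
    using that F(2) G(2) min_word_in by blast
  \<comment> \<open>Pads a sum to the common index set. This is possible only modulo the relations,
    since \<open>fP (\<lambda>x. 0)\<close> is a nonzero element of the free algebra.\<close>
  have ext: "(\<Sum>y\<in>H. fP (r y) * refl_word (min_word y)) \<approx>
      (\<Sum>y\<in>F \<union> G. fP (if y \<in> H then r y else (\<lambda>x. 0)) * refl_word (min_word y))"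
    if "H \<subseteq> F \<union> G" "\<And>y. r y \<in> polys n" for H r
  proof -
    have "(\<Sum>y\<in>H. fP (r y) * refl_word (min_word y)) =
       (\<Sum>y\<in>F \<union> G. (if y \<in> H then fP (r y) * refl_word (min_word y) else 0 * refl_word (min_word y)))"
      using that F(1) G(1) by (simp add: sum.If_cases Int_absorb1)
    also have "\<dots> \<approx> (\<Sum>y\<in>F \<union> G. fP (if y \<in> H then r y else (\<lambda>x. 0)) * refl_word (min_word y))"
    proof (rule eqv_sum)
      fix y assume y: "y \<in> F \<union> G"
      show "(if y \<in> H then fP (r y) * refl_word (min_word y) else 0 * refl_word (min_word y)) \<approx>
         fP (if y \<in> H then r y else (\<lambda>x. 0)) * refl_word (min_word y)"
        using that(2)[of y] R[OF y] eqv_mult[OF eqv_sym[OF eqv_fP_zero] eqv_refl[OF R[OF y]]]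
        by (auto intro!: eqv_refl free_alg_in)
    qed
    finally show ?thesis .
  qed
  have "a + b \<approx> (\<Sum>y\<in>F \<union> G. fP (p' y) * refl_word (min_word y)) + (\<Sum>y\<in>F \<union> G. fP (q' y) * refl_word (min_word y))"
    unfolding p'_def q'_def by (intro eqv_add eqv_trans[OF F(4) ext] eqv_trans[OF G(4) ext] F G) auto
  also have "\<dots> = (\<Sum>y\<in>F \<union> G. (fP (p' y) + fP (q' y)) * refl_word (min_word y))"
    by (simp add: sum.distrib distrib_right)
  also have "\<dots> \<approx> (\<Sum>y\<in>F \<union> G. fP (\<lambda>x. p' y x + q' y x) * refl_word (min_word y))"
    using R by (intro eqv_sum eqv_mult eqv_refl eqv_sym[OF eqv_fP_add] pq)
  finally show ?thesis unfolding spanned_def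
    using F(1,2) G(1,2) pq by (intro CollectI exI[of _ "F \<union> G"] exI[of _ "\<lambda>y x. p' y x + q' y x"])
      (auto intro: polys.add)
qed

lemma spanned_zero: "0 \<in> spanned"
  unfolding spanned_def by (intro CollectI exI[of _ "{}"] exI[of _ "\<lambda>y x. 0"])
    (auto intro: polys.const eqv_refl free_alg_in)

lemma spanned_sum: "(\<And>i. i \<in> F \<Longrightarrow> f i \<in> spanned) \<Longrightarrow> sum f F \<in> spanned"
  by (induction F rule: infinite_finite_induct) (auto intro: spanned_zero spanned_add)

lemma spanned_term:
  assumes "p \<in> polys n" "set u \<subseteq> {0..n}" shows "fP p * refl_word u \<in> spanned"
proof -
  let ?y = "fold (irefl n) u (base_pt n)"
  have u: "is_word ?y u" using assms by (simp add: is_word_def)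
  have "fP p * refl_word u \<approx> fP p * refl_word (min_word ?y)"
    using u min_word[OF u] assms by (intro eqv_mult eqv_refl free_alg_in is_word_eqv) auto
  then show ?thesis unfolding spanned_def using u assms
    by (intro CollectI exI[of _ "{?y}"] exI[of _ "\<lambda>y. p"]) auto
qed

lemma spanned_induct_terms:
  assumes "a \<in> spanned" "b \<in> carrier (free_alg n)"
    and "\<And>p u. p \<in> polys n \<Longrightarrow> set u \<subseteq> {0..n} \<Longrightarrow> fP p * refl_word u * b \<in> spanned"
  shows "a * b \<in> spanned"
proof -
  obtain F p where F: "finite F" "\<And>y. y \<in> F \<Longrightarrow> \<exists>w. is_word y w" "\<And>y. p y \<in> polys n"
    "a \<approx> (\<Sum>y\<in>F. fP (p y) * refl_word (min_word y))" using assms(1) unfolding spanned_def by blast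
  have "a * b \<approx> (\<Sum>y\<in>F. fP (p y) * refl_word (min_word y)) * b"
    by (intro eqv_mult F eqv_refl assms)
  also have "\<dots> = (\<Sum>y\<in>F. fP (p y) * refl_word (min_word y) * b)" by (simp add: sum_distrib_right)
  finally show ?thesis
  proof (rule spanned_cong, intro spanned_sum assms(3) F)
    fix y assume "y \<in> F"
    then show "set (min_word y) \<subseteq> {0..n}" using F(2) min_word(1) unfolding is_word_def by blast
  qed
qed

lemma spanned_mult_fR: assumes "a \<in> spanned" "i \<le> n" shows "a * fR i \<in> spanned"
proof (rule spanned_induct_terms[OF assms(1) fR_in[OF assms(2)]])
  fix p u assume "p \<in> polys n" "set u \<subseteq> {0..n}"
  then have "fP p * refl_word (u @ [i]) \<in> spanned" using assms by (intro spanned_term) auto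
  then show "fP p * refl_word u * fR i \<in> spanned" by (simp add: refl_word_append refl_word_def mult.assoc)
qed

text \<open>The cross-relation moves \<open>q\<close> past the last letter and replaces it by two
  other polynomials, the reflected \<open>q\<close> and a multiple of a divided difference, each
  facing a shorter word; hence the induction is for all \<open>q\<close> at once.\<close>

lemma spanned_term_mult_fP:
  assumes "set u \<subseteq> {0..n}" "p \<in> polys n" "q \<in> polys n"
  shows "fP p * refl_word u * fP q \<in> spanned"
  using assms
proof (induction u arbitrary: q rule: rev_induct)
  case Nil
  have "fP p * refl_word [] * fP q \<approx> fP (\<lambda>x. p x * q x) * refl_word []"
    using eqv_sym[OF eqv_fP_mult] Nil by (simp add: refl_word_def)
  then show ?case using Nil by (elim spanned_cong) (auto intro!: spanned_term polys.mult)
next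
  case (snoc i u)
  then have i: "i \<le> n" by auto
  let ?q = "refl_act n i q" and ?d = "\<lambda>x. kpar n t i * divided_difference n i q x"
  have pol: "?q \<in> polys n" "?d \<in> polys n"
    using n i snoc.prems by (auto intro!: polys_refl_act polys.intros divided_difference)
  have "fP p * refl_word (u @ [i]) * fP q = (fP p * refl_word u) * (fR i * fP q)"
    by (simp add: refl_word_append refl_word_def mult.assoc)
  also have "\<dots> \<approx> (fP p * refl_word u) * (fP ?q * fR i + fP ?d)"
    using snoc.prems i by (intro eqv_mult eqv_refl eqv_cross free_alg_in refl_word_in) auto
  also have "\<dots> = fP p * refl_word u * fP ?q * fR i + fP p * refl_word u * fP ?d"
    by (simp add: algebra_simps)
  finally show ?case
    using snoc.prems by (rule_tac spanned_cong) (auto intro!: spanned_add spanned_mult_fR snoc.IH pol i)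
qed

lemma spanned_mult_fP: "a \<in> spanned \<Longrightarrow> q \<in> polys n \<Longrightarrow> a * fP q \<in> spanned"
  by (rule spanned_induct_terms) (auto intro: fP_in spanned_term_mult_fP)

lemma spanned_all: assumes "a \<in> carrier (free_alg n)" shows "a \<in> spanned"
proof -
  have "Poly_Mapping.single w c \<in> spanned" if "set w \<subseteq> gens n" for w c
    using that
  proof (induction w rule: rev_induct)
    case Nil
    have "Poly_Mapping.single [] c \<approx> fP (\<lambda>x. c) * refl_word []"
      using eqv_sym[OF eqv_fP_const[of c]] by (simp add: fC_def refl_word_def)
    then show ?case by (rule spanned_cong) (auto intro!: spanned_term polys.const)
  next
    case (snoc g w)
    have "Poly_Mapping.single (w @ [g]) c = Poly_Mapping.single w c * Poly_Mapping.single [g] 1"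
      by (simp add: mult_single plus_list_def)
    then show ?case using snoc spanned_mult_fR[of "Poly_Mapping.single w c"] spanned_mult_fP[of "Poly_Mapping.single w c"]
      by (auto simp: gens_def fR_def fP_def)
  qed
  then have "(\<Sum>w\<in>Poly_Mapping.keys a. Poly_Mapping.single w (Poly_Mapping.lookup a w)) \<in> spanned"
    using assms by (intro spanned_sum) (auto simp: free_alg_carrier)
  then show ?thesis by (simp flip: poly_mapping_sum_singles)
qed

section \<open>Leading terms at a generic point, and faithfulness\<close>

definition generic :: "nat \<Rightarrow> (nat \<Rightarrow> complex) \<Rightarrow> bool" where
  "generic m x \<longleftrightarrow> (\<forall>v i. set v \<subseteq> {0..n} \<longrightarrow> length v < m \<longrightarrow> i \<le> n \<longrightarrow>
     aroot n i (fold (refl_pt n) v x) \<noteq> 0 \<and> aroot n i (fold (refl_pt n) v x) + kpar n t i \<noteq> 0)"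

text \<open>The first letter contributes \<open>1 + k_i / a_i\<close> times a value at the reflected
  point, minus \<open>k_i / a_i\<close> times a value at \<open>x\<close> itself; the latter
  involves only shorter words, where \<open>p\<close> vanishes. The two conditions in
  \<open>generic\<close> make this formula valid and its leading factor nonzero.\<close>

lemma refl_word_leading_term:
  assumes "set w \<subseteq> {0..n}" "generic (length w) x" "p \<in> polys n"
    and "\<And>v. set v \<subseteq> {0..n} \<Longrightarrow> length v < length w \<Longrightarrow> p (fold (refl_pt n) v x) = 0"
  shows "\<exists>c. c \<noteq> 0 \<and> free_op n t (refl_word w) p x = c * p (fold (refl_pt n) w x)"
  using assms(1,2,4)
proof (induction w arbitrary: x)
  case Nil
  show ?case by (intro exI[of _ 1]) (simp add: refl_word_def free_op_one)
next
  case (Cons i w)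
  have i: "i \<le> n" and w: "set w \<subseteq> {0..n}" using Cons.prems by auto
  have ne: "aroot n i x \<noteq> 0" "aroot n i x + kpar n t i \<noteq> 0"
    using Cons.prems(2)[unfolded generic_def, rule_format, of "[]" i] i by auto
  have "generic (length w) (refl_pt n i x)" unfolding generic_def
  proof (intro allI impI)
    fix v j assume "set v \<subseteq> {0..n}" "length v < length w" "j \<le> n"
    then show "aroot n j (fold (refl_pt n) v (refl_pt n i x)) \<noteq> 0 \<and>
        aroot n j (fold (refl_pt n) v (refl_pt n i x)) + kpar n t j \<noteq> 0"
      using Cons.prems(2)[unfolded generic_def, rule_format, of "i # v" j] i by auto
  qed
  moreover have "p (fold (refl_pt n) v (refl_pt n i x)) = 0" if "set v \<subseteq> {0..n}" "length v < length w" for v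
    using Cons.prems(3)[of "i # v"] that i by auto
  ultimately obtain c where c: "c \<noteq> 0"
      "free_op n t (refl_word w) p (refl_pt n i x) = c * p (fold (refl_pt n) w (refl_pt n i x))"
    using Cons.IH[OF w] by blast
  \<comment> \<open>The induction hypothesis a second time, at \<open>x\<close> itself: since
    \<open>w\<close> is shorter than \<open>i # w\<close>, the value of \<open>p\<close> it refers
    to is zero.\<close>
  have "generic (length w) x" using Cons.prems(2) by (auto simp: generic_def)
  then obtain c' where "free_op n t (refl_word w) p x = c' * p (fold (refl_pt n) w x)"
    using Cons.IH[OF w] Cons.prems(3) by fastforce
  then have 0: "free_op n t (refl_word w) p x = 0" using Cons.prems(3)[of w] w by simp
  have "refl_word (i # w) = fR i * refl_word w" by (simp add: refl_word_def)
  then have "free_op n t (refl_word (i # w)) p x = dunkl n t i (free_op n t (refl_word w) p) x"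
    using assms(3) i w by (simp add: free_op_mult free_op_fR fR_in refl_word_in)
  also have "\<dots> = (1 + kpar n t i / aroot n i x) * c * p (fold (refl_pt n) (i # w) x)"
    using dunkl_eq[OF n i free_op_polys[OF refl_word_in[OF w] assms(3)] ne(1), of t] c 0 by simp
  finally show ?case using ne c(1)
    by (intro exI[of _ "(1 + kpar n t i / aroot n i x) * c"]) (simp add: add_divide_eq_iff)
qed

text \<open>Undoes the dilation, turning the integer orbit into an orbit of the original
  action.\<close>

definition scaled_pt :: "(nat \<Rightarrow> int) \<Rightarrow> nat \<Rightarrow> complex" where
  "scaled_pt y j = of_int (y j) / of_int (2 * int n + 1)"

lemma scaled_modulus_nonzero: "(of_int (2 * int n + 1) :: complex) \<noteq> 0"
  unfolding of_int_eq_0_iff by linarith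

lemma refl_pt_scaled_pt: "refl_pt n i (scaled_pt y) = scaled_pt (irefl n i y)"
  using n scaled_modulus_nonzero
  by (auto simp: refl_pt_def irefl_def scaled_pt_def fun_eq_iff diff_divide_distrib simp del: of_int_add of_int_mult)

lemma fold_refl_pt_scaled_pt: "fold (refl_pt n) w (scaled_pt y) = scaled_pt (fold (irefl n) w y)"
  by (induction w arbitrary: y) (auto simp: refl_pt_scaled_pt)

lemma finite_short_words: "finite {v. set v \<subseteq> {0..n} \<and> length v \<le> m}"
  by (rule finite_lists_length_le) simp

text \<open>All requirements say that finitely many nonzero polynomials do not vanish at
  \<open>x\<close>: \<open>A\<close> and \<open>B\<close> express genericity, and \<open>C\<close>
  ensures that words moving the base point to different places do the same to
  \<open>x\<close>.\<close>

lemma generic_point_exists: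
  assumes "q \<in> polys n" "q \<noteq> (\<lambda>x. 0)"
  shows "\<exists>x. generic m x \<and> q x \<noteq> 0 \<and> (\<forall>u v. set u \<subseteq> {0..n} \<longrightarrow> set v \<subseteq> {0..n} \<longrightarrow> length u \<le> m \<longrightarrow> length v \<le> m \<longrightarrow>
     fold (irefl n) u (base_pt n) \<noteq> fold (irefl n) v (base_pt n) \<longrightarrow>
     (\<exists>j\<in>{1..n}. fold (refl_pt n) u x j \<noteq> fold (refl_pt n) v x j))"
proof -
  define V where "V = {v. set v \<subseteq> {0..n} \<and> length v \<le> m}"
  have V: "finite V" unfolding V_def by (rule finite_short_words)
  define A where "A = (\<lambda>(i, v) x. aroot n i (fold (refl_pt n) v x)) ` ({0..n} \<times> V)"
  define B where "B = (\<lambda>(i, v) x. aroot n i (fold (refl_pt n) v x) + kpar n t i) ` ({0..n} \<times> V)"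
  define D where "D = {((u, v), j) \<in> (V \<times> V) \<times> {1..n}. fold (irefl n) u (base_pt n) j \<noteq> fold (irefl n) v (base_pt n) j}"
  define C where "C = (\<lambda>((u, v), j) x. fold (refl_pt n) u x j - fold (refl_pt n) v x j) ` D"
  have "finite D" unfolding D_def by (rule finite_subset[of _ "(V \<times> V) \<times> {1..n}"]) (use V in auto)
  then have fin: "finite (insert q (A \<union> B \<union> C))" using V unfolding A_def B_def C_def by auto
  have comp: "(\<lambda>x. p (fold (refl_pt n) v x)) \<in> polys n" if "v \<in> V" "p \<in> polys n" for v p
    using that polys_fold_refl_pt[OF n] by (auto simp: V_def)
  have coord: "(\<lambda>x. fold (refl_pt n) v x j) \<in> polys n" if "v \<in> V" "j \<in> {1..n}" for v j
    using comp[OF that(1) polys.coord, of j] that(2) by simp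
  have pol: "f \<in> polys n" if "f \<in> insert q (A \<union> B \<union> C)" for f
    using that assms(1) n
    by (auto simp: A_def B_def C_def D_def intro!: comp polys_aroot polys.add polys.const polys_diff coord)
  have ne: "\<exists>x. f x \<noteq> 0" if "f \<in> insert q (A \<union> B \<union> C)" for f
    using that
  proof (elim insertE UnE)
    assume "f = q" then show ?thesis using assms(2) by (auto simp: fun_eq_iff)
  next
    assume "f \<in> A"
    then obtain i v where "i \<le> n" "set v \<subseteq> {0..n}" "f = (\<lambda>x. aroot n i (fold (refl_pt n) v x))"
      by (auto simp: A_def V_def)
    then show ?thesis using polys_aroot_comp(2)[OF n, of i v 1] by auto (metis one_neq_zero)
  next
    assume "f \<in> B"
    then obtain i v where "i \<le> n" "set v \<subseteq> {0..n}" "f = (\<lambda>x. aroot n i (fold (refl_pt n) v x) + kpar n t i)"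
      by (auto simp: B_def V_def)
    then show ?thesis using polys_aroot_comp(2)[OF n, of i v "1 - kpar n t i"] by auto (metis diff_add_cancel one_neq_zero)
  next
    assume "f \<in> C"
    then obtain u v j where uv: "fold (irefl n) u (base_pt n) j \<noteq> fold (irefl n) v (base_pt n) j"
      "f = (\<lambda>x. fold (refl_pt n) u x j - fold (refl_pt n) v x j)" by (auto simp: C_def D_def)
    \<comment> \<open>The scaled base point itself shows that this coordinate difference is not the
      zero polynomial.\<close>
    then have "f (scaled_pt (base_pt n)) \<noteq> 0"
      using scaled_modulus_nonzero by (simp add: fold_refl_pt_scaled_pt scaled_pt_def del: of_int_add of_int_mult)
    then show ?thesis by blast
  qed
  obtain x where x: "\<And>f. f \<in> insert q (A \<union> B \<union> C) \<Longrightarrow> f x \<noteq> 0"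
    using polys_common_nonzero[OF fin pol ne] by blast
  show ?thesis
  proof (intro exI[of _ x] conjI allI impI)
    show "generic m x" unfolding generic_def
    proof (intro allI impI)
      fix v i assume "set v \<subseteq> {0..n}" "length v < m" "i \<le> n"
      then have "(i, v) \<in> {0..n} \<times> V" by (auto simp: V_def)
      then have "(\<lambda>x. aroot n i (fold (refl_pt n) v x)) \<in> A" "(\<lambda>x. aroot n i (fold (refl_pt n) v x) + kpar n t i) \<in> B"
        unfolding A_def B_def by force+
      then show "aroot n i (fold (refl_pt n) v x) \<noteq> 0 \<and> aroot n i (fold (refl_pt n) v x) + kpar n t i \<noteq> 0"
        using x[of "\<lambda>x. aroot n i (fold (refl_pt n) v x)"] x[of "\<lambda>x. aroot n i (fold (refl_pt n) v x) + kpar n t i"] by auto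
    qed
    show "q x \<noteq> 0" using x by blast
    fix u v assume uv: "set u \<subseteq> {0..n}" "set v \<subseteq> {0..n}" "length u \<le> m" "length v \<le> m"
      "fold (irefl n) u (base_pt n) \<noteq> fold (irefl n) v (base_pt n)"
    have "fold (irefl n) w (base_pt n) j = base_pt n j" if "j \<notin> {1..n}" "set w \<subseteq> {0..n}" for w j
      using fold_irefl_regular[OF n that(2) base_pt_regular] that(1) by (auto simp: regular_pts_def)
    then obtain j where j: "j \<in> {1..n}" "fold (irefl n) u (base_pt n) j \<noteq> fold (irefl n) v (base_pt n) j"
      using uv by (metis ext)
    then have "((u, v), j) \<in> D" using uv by (auto simp: D_def V_def)
    then have "(\<lambda>x. fold (refl_pt n) u x j - fold (refl_pt n) v x j) \<in> C" unfolding C_def by force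
    from x[OF insertI2[OF UnI2[OF this]]] j(1)
    show "\<exists>j\<in>{1..n}. fold (refl_pt n) u x j \<noteq> fold (refl_pt n) v x j" by auto
  qed
qed

text \<open>Among the nonzero coefficients take one with a longest word \<open>w0\<close>. At a
  generic point it is isolated by a test polynomial \<open>P\<close> vanishing at the images under
  all words of at most that length, apart from those that represent the same group element.\<close>

theorem free_op_faithful:
  assumes a: "a \<in> carrier (free_alg n)" and zero: "\<And>p. p \<in> polys n \<Longrightarrow> free_op n t a p = (\<lambda>x. 0)"
  shows "a \<in> rel_ideal n t"
proof -
  obtain F p where F: "finite F" "\<And>y. y \<in> F \<Longrightarrow> \<exists>w. is_word y w" "\<And>y. p y \<in> polys n"
    "a \<approx> (\<Sum>y\<in>F. fP (p y) * refl_word (min_word y))"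
    using spanned_all[OF a] unfolding spanned_def by blast
  have word: "is_word y (min_word y)" if "y \<in> F" for y using F(2)[OF that] min_word(1) by blast
  have word_set: "set (min_word y) \<subseteq> {0..n}" if "y \<in> F" for y
    using word[OF that] by (simp add: is_word_def)
  have "p y = (\<lambda>x. 0)" if "y \<in> F" for y
  proof (rule ccontr)
    assume "p y \<noteq> (\<lambda>x. 0)"
    define F' where "F' = {y \<in> F. p y \<noteq> (\<lambda>x. 0)}"
    have "finite F'" "F' \<noteq> {}" using F(1) \<open>y \<in> F\<close> \<open>p y \<noteq> _\<close> by (auto simp: F'_def)
    then obtain y0 where y0: "y0 \<in> F'" "\<And>y. y \<in> F' \<Longrightarrow> length (min_word y) \<le> length (min_word y0)"
      using obtains_MAX[of F' "\<lambda>y. length (min_word y)"] by (metis Max_ge finite_imageI imageI)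
    define w0 where "w0 = min_word y0"
    have w0: "set w0 \<subseteq> {0..n}" "fold (irefl n) w0 (base_pt n) = y0"
      using word y0(1) by (auto simp: F'_def is_word_def w0_def)
    obtain x where x: "generic (length w0) x" "p y0 x \<noteq> 0"
      "\<And>u v. set u \<subseteq> {0..n} \<Longrightarrow> set v \<subseteq> {0..n} \<Longrightarrow> length u \<le> length w0 \<Longrightarrow> length v \<le> length w0 \<Longrightarrow>
        fold (irefl n) u (base_pt n) \<noteq> fold (irefl n) v (base_pt n) \<Longrightarrow>
        \<exists>j\<in>{1..n}. fold (refl_pt n) u x j \<noteq> fold (refl_pt n) v x j"
      using generic_point_exists[OF F(3)[of y0], of "length w0"] y0(1) unfolding F'_def by blast
    \<comment> \<open>Contains the other basis words with nonzero coefficient as well as all words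
      shorter than \<open>w0\<close>, so that a single \<open>P\<close> both removes the other terms
      and meets the hypothesis of \<open>refl_word_leading_term\<close>.\<close>
    define V where "V = {v. (set v \<subseteq> {0..n} \<and> length v \<le> length w0) \<and> fold (irefl n) v (base_pt n) \<noteq> y0}"
    have "finite V" unfolding V_def
      by (rule finite_subset[OF _ finite_short_words[of "length w0"]]) auto
    moreover have "\<exists>j\<in>{1..n}. z j \<noteq> fold (refl_pt n) w0 x j" if "z \<in> (\<lambda>v. fold (refl_pt n) v x) ` V" for z
      using that w0 x(3)[of _ w0] by (auto simp: V_def)
    ultimately obtain P where P: "P \<in> polys n" "P (fold (refl_pt n) w0 x) \<noteq> 0" "\<And>v. v \<in> V \<Longrightarrow> P (fold (refl_pt n) v x) = 0"
      using polys_separate[of "(\<lambda>v. fold (refl_pt n) v x) ` V" n "fold (refl_pt n) w0 x"] by auto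
    have lower: "P (fold (refl_pt n) v x) = 0" if "set v \<subseteq> {0..n}" "length v < length w0" for v
    proof (rule P(3))
      have "fold (irefl n) v (base_pt n) \<noteq> y0"
        using min_word(2)[of y0 v] that by (auto simp: is_word_def w0_def)
      then show "v \<in> V" using that by (simp add: V_def)
    qed
    have lead: "\<exists>c. c \<noteq> 0 \<and> free_op n t (refl_word (min_word y)) P x = c * P (fold (refl_pt n) (min_word y) x)"
      if "y \<in> F'" for y
    proof (rule refl_word_leading_term)
      show "set (min_word y) \<subseteq> {0..n}" using that word_set by (auto simp: F'_def)
      show "generic (length (min_word y)) x" using x(1) y0(2)[OF that] by (auto simp: generic_def w0_def)
      show "P (fold (refl_pt n) v x) = 0" if "set v \<subseteq> {0..n}" "length v < length (min_word y)" for v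
        using lower[of v] that y0(2)[OF \<open>y \<in> F'\<close>] by (simp add: w0_def)
    qed (rule P(1))
    have other: "p y x * free_op n t (refl_word (min_word y)) P x = 0" if "y \<in> F" "y \<noteq> y0" for y
    proof (cases "y \<in> F'")
      case True
      then have "min_word y \<in> V" using word[OF that(1)] that(2) y0(2)[OF True] by (simp add: V_def is_word_def w0_def)
      then show ?thesis using lead[OF True] P(3) by auto
    next
      case False then show ?thesis using that by (simp add: F'_def)
    qed
    have "free_op n t a P x = (\<Sum>y\<in>F. p y x * free_op n t (refl_word (min_word y)) P x)"
    proof -
      have "free_op n t (a - (\<Sum>y\<in>F. fP (p y) * refl_word (min_word y))) P x = 0"
        using rel_ideal_acts_trivially[OF _ P(1)] F(4) by (simp add: eqv_def)
      then have "free_op n t a P x = free_op n t (\<Sum>y\<in>F. fP (p y) * refl_word (min_word y)) P x"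
        by (simp add: free_op_diff)
      also have "\<dots> = (\<Sum>y\<in>F. p y x * free_op n t (refl_word (min_word y)) P x)"
        unfolding free_op_sum
        by (rule sum.cong) (auto simp: free_op_mult fP_in F(3) refl_word_in[OF word_set] P(1) free_op_fP)
      finally show ?thesis .
    qed
    also have "\<dots> = p y0 x * free_op n t (refl_word (min_word y0)) P x"
      using F(1) y0(1) other by (subst sum.remove[of F y0]) (auto simp: F'_def intro!: sum.neutral)
    also have "\<dots> \<noteq> 0" using lead[OF y0(1)] P(2) x(2) by (auto simp: w0_def)
    finally show False using zero[OF P(1)] by simp
  qed
  then have "(\<Sum>y\<in>F. fP (p y) * refl_word (min_word y)) = (\<Sum>y\<in>F. fP (\<lambda>x. 0) * refl_word (min_word y))"
    by (intro sum.cong) auto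
  also have "\<dots> \<approx> (\<Sum>y\<in>F. 0 * refl_word (min_word y))"
    by (intro eqv_sum eqv_mult eqv_fP_zero eqv_refl refl_word_in word_set)
  finally have "(\<Sum>y\<in>F. fP (p y) * refl_word (min_word y)) \<approx> 0" by simp
  from eqv_trans[OF F(4) this] show ?thesis by (simp add: eqv_def)
qed

end

section \<open>The induced representation\<close>

text \<open>Stated for additive subgroups so as to serve both the two-sided ideal of relations and
  the left ideal \<open>ind_kernel\<close>.\<close>

lemma (in ring) a_coset_eq_iff:
  assumes "subgroup H (add_monoid R)" "x \<in> carrier R" "y \<in> carrier R"
  shows "H +> x = H +> y \<longleftrightarrow> x \<ominus> y \<in> H"
proof -
  interpret abelian_subgroup H R
    by (intro abelian_subgroupI3 additive_subgroupI assms is_abelian_group)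
  show ?thesis
    using a_rcos_module_minus[OF ring_axioms assms(3,2)] a_repr_independence[OF _ assms(3,1)] a_rcos_self[OF assms(2)]
    by blast
qed

section \<open>The action of the quotient algebra\<close>

definition daha_op :: "nat \<Rightarrow> daha_params \<Rightarrow> free set \<Rightarrow> cfun \<Rightarrow> cfun" where
  "daha_op n t h = free_op n t (SOME a. a \<in> carrier (free_alg n) \<and> cls n t a = h)"

lemma rat_daha_ops [simp]:
  "monoid.mult (rat_daha n t) = monoid.mult (trig_daha n t)" "one (rat_daha n t) = one (trig_daha n t)"
  "zero (rat_daha n t) = zero (trig_daha n t)" "add (rat_daha n t) = add (trig_daha n t)"
  by (simp_all add: rat_daha_def)

lemma hecke_H_ops [simp]:
  "monoid.mult (hecke_H n t) = monoid.mult (trig_daha n t)" "one (hecke_H n t) = one (trig_daha n t)"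
  "zero (hecke_H n t) = zero (trig_daha n t)" "add (hecke_H n t) = add (trig_daha n t)"
  by (simp_all add: hecke_H_def)

context
  fixes n :: nat and t :: daha_params
  assumes n: "n \<ge> 2"
begin

interpretation A: ring "trig_daha n t"
  unfolding trig_daha_def by (rule ideal.quotient_is_ring[OF rel_ideal_ideal[OF n]])

lemma cls_hom: "cls n t \<in> ring_hom (free_alg n) (trig_daha n t)"
  using ideal.rcos_ring_hom[OF rel_ideal_ideal[OF n]] unfolding trig_daha_def cls_def[abs_def] .

lemma trig_daha_carrier: "carrier (trig_daha n t) = cls n t ` carrier (free_alg n)"
  unfolding trig_daha_def cls_def[abs_def] by (auto simp: FactRing_def A_RCOSETS_def')

lemma cls_eq_iff:
  assumes "a \<in> carrier (free_alg n)" "b \<in> carrier (free_alg n)"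
  shows "cls n t a = cls n t b \<longleftrightarrow> a - b \<in> rel_ideal n t"
  using ring.a_coset_eq_iff[OF ring_free_alg additive_subgroup.a_subgroup[OF ideal.axioms(1)[OF rel_ideal_ideal[OF n]]] assms]
  assms by (simp add: cls_def a_minus_def free_alg_a_inv)

text \<open>Two representatives differ by an element of the ideal, which acts as zero, so
  \<open>daha_op\<close> is well defined on classes.\<close>

lemma daha_op_cls:
  assumes "a \<in> carrier (free_alg n)" "p \<in> polys n"
  shows "daha_op n t (cls n t a) p = free_op n t a p"
proof -
  define b where "b = (SOME b. b \<in> carrier (free_alg n) \<and> cls n t b = cls n t a)"
  have "b \<in> carrier (free_alg n) \<and> cls n t b = cls n t a"
    unfolding b_def by (rule someI[of _ a]) (simp add: assms)
  then have "free_op n t (b - a) p = (\<lambda>x. 0)"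
    using rel_ideal_acts_trivially[OF n _ assms(2)] cls_eq_iff assms by blast
  then show ?thesis by (auto simp: daha_op_def free_op_diff fun_eq_iff simp flip: b_def)
qed

lemma daha_op_polys: "h \<in> carrier (trig_daha n t) \<Longrightarrow> p \<in> polys n \<Longrightarrow> daha_op n t h p \<in> polys n"
  by (auto simp: trig_daha_carrier daha_op_cls free_op_polys[OF n])

text \<open>Faithfulness carried over to the quotient. From here on identities in the algebra are
  proved by comparing operators.\<close>

lemma daha_op_eqI:
  assumes "h \<in> carrier (trig_daha n t)" "g \<in> carrier (trig_daha n t)"
    "\<And>p. p \<in> polys n \<Longrightarrow> daha_op n t h p = daha_op n t g p"
  shows "h = g"
proof -
  obtain a b where ab: "a \<in> carrier (free_alg n)" "h = cls n t a" "b \<in> carrier (free_alg n)" "g = cls n t b"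
    using assms by (auto simp: trig_daha_carrier)
  have "a - b \<in> rel_ideal n t"
    using ab assms(3) by (intro free_op_faithful[OF n]) (auto simp: daha_op_cls free_op_diff fun_eq_iff intro: free_alg_in)
  then show ?thesis using ab cls_eq_iff by blast
qed

lemma daha_op_add:
  assumes "h \<in> carrier (trig_daha n t)" "g \<in> carrier (trig_daha n t)" "p \<in> polys n"
  shows "daha_op n t (h \<oplus>\<^bsub>trig_daha n t\<^esub> g) p = (\<lambda>x. daha_op n t h p x + daha_op n t g p x)"
  using assms ring_hom_add[OF cls_hom]
  by (auto simp: trig_daha_carrier daha_op_cls free_op_add free_alg_in simp flip: ring_hom_add[OF cls_hom])

lemma daha_op_mult:
  assumes "h \<in> carrier (trig_daha n t)" "g \<in> carrier (trig_daha n t)" "p \<in> polys n"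
  shows "daha_op n t (h \<otimes>\<^bsub>trig_daha n t\<^esub> g) p = daha_op n t h (daha_op n t g p)"
  using assms
  by (auto simp: trig_daha_carrier daha_op_cls free_op_mult[OF n] free_op_polys[OF n] free_alg_in simp flip: ring_hom_mult[OF cls_hom])

lemma daha_op_one: "p \<in> polys n \<Longrightarrow> daha_op n t \<one>\<^bsub>trig_daha n t\<^esub> p = p"
  using ring_hom_one[OF cls_hom] daha_op_cls[OF free_alg_one_in] free_op_one[OF n] by simp

lemma daha_op_zero: "p \<in> polys n \<Longrightarrow> daha_op n t \<zero>\<^bsub>trig_daha n t\<^esub> p = (\<lambda>x. 0)"
  using daha_op_add[of "\<zero>\<^bsub>trig_daha n t\<^esub>" "\<zero>\<^bsub>trig_daha n t\<^esub>" p] by (auto simp: fun_eq_iff)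

lemma daha_op_add_arg:
  "h \<in> carrier (trig_daha n t) \<Longrightarrow> p \<in> polys n \<Longrightarrow> q \<in> polys n \<Longrightarrow>
    daha_op n t h (\<lambda>x. p x + q x) = (\<lambda>x. daha_op n t h p x + daha_op n t h q x)"
  by (auto simp: trig_daha_carrier daha_op_cls free_op_add_arg[OF n] polys.add)

lemma daha_op_scale_arg:
  "h \<in> carrier (trig_daha n t) \<Longrightarrow> p \<in> polys n \<Longrightarrow>
    daha_op n t h (\<lambda>x. c * p x) = (\<lambda>x. c * daha_op n t h p x)"
  by (auto simp: trig_daha_carrier daha_op_cls free_op_scale_arg[OF n] polys.intros)

lemma scal_in: "scal n t c \<in> carrier (trig_daha n t)"
  by (auto simp: scal_def trig_daha_carrier fC_in)

lemma polX_in: "p \<in> polys n \<Longrightarrow> polX n t p \<in> carrier (trig_daha n t)"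
  by (auto simp: polX_def trig_daha_carrier fP_in)

lemma daha_op_scal: "p \<in> polys n \<Longrightarrow> daha_op n t (scal n t c) p = (\<lambda>x. c * p x)"
  by (simp add: scal_def daha_op_cls fC_in free_op_fC[OF n])

lemma daha_op_polX: "p \<in> polys n \<Longrightarrow> q \<in> polys n \<Longrightarrow> daha_op n t (polX n t q) p = (\<lambda>x. q x * p x)"
  by (simp add: polX_def daha_op_cls fP_in free_op_fP[OF n])

lemma Tgen_in: "i \<le> n \<Longrightarrow> Tgen n t i \<in> carrier (trig_daha n t)"
  using n by (auto simp: Tgen_def trig_daha_carrier intro!: imageI free_alg_in polys_acheck)

text \<open>For \<open>i = 0\<close> and \<open>i = n\<close>, with \<open>v\<close> the value of
  \<open>acheck n i\<close>, the root is \<open>2 v\<close> and the coefficient of the reflection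
  becomes \<open>(t_i - u_i + v) (1 + (t_i + u_i) / v) / 2 = ((t_i + v)^2 - u_i^2) / (2 v)\<close>,
  which is \<open>d_i + t_i = c_i\<close>.\<close>

lemma daha_op_Tgen:
  assumes "i \<le> n" "p \<in> polys n" "aroot n i x \<noteq> 0"
  shows "daha_op n t (Tgen n t i) p x = cfct n t i x * refl_act n i p x - dfct n t i x * p x"
proof (cases "i = 0 \<or> i = n")
  case True
  let ?v = "acheck n i x" and ?T = "tpar t i" and ?U = "upar t i"
  have root: "aroot n i x = 2 * ?v" using True n by (auto simp: aroot_def acheck_def)
  have k: "kpar n t i = 2 * ?T + 2 * ?U" using True n by (auto simp: kpar_def tpar_def upar_def)
  have v: "?v \<noteq> 0" using assms(3) root by simp
  have "daha_op n t (Tgen n t i) p x = ?T * p x + 1 / 2 * (?T - ?U + ?v) * (dunkl n t i p x - p x)"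
    using True assms n
    by (simp add: Tgen_def daha_op_cls free_op_add free_op_mult[OF n] free_op_diff free_op_fC[OF n] free_op_fP[OF n]
      free_op_fR[OF n] free_op_one[OF n] free_op_polys[OF n] free_alg_in polys_acheck dunkl_polys polys_diff)
      (simp add: algebra_simps)
  also have "\<dots> = cfct n t i x * refl_act n i p x - dfct n t i x * p x"
    unfolding dunkl_eq[OF n assms] k root cfct_def dfct_def chi_def refl_act_def using True v
    by (simp add: field_simps power2_eq_square)
  finally show ?thesis .
next
  case False
  then have "kpar n t i = par_t t" by (simp add: kpar_def)
  then show ?thesis using False assms n
    by (simp add: Tgen_def daha_op_cls fR_in free_op_fR[OF n] dunkl_eq cfct_def dfct_def chi_def refl_act_def algebra_simps)
qed

text \<open>Reflections fix constants, and \<open>cfct - dfct\<close> is the constant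
  \<open>chi\<close>.\<close>

lemma daha_op_Tgen_const:
  assumes "i \<le> n"
  shows "daha_op n t (Tgen n t i) (\<lambda>x. c) = (\<lambda>x. chi n t i * c)"
  by (rule polys_eqI_aroot[OF n _ _ assms])
    (use assms in \<open>auto simp: daha_op_Tgen polys.const daha_op_polys Tgen_in refl_act_def cfct_def algebra_simps\<close>)

abbreviation (input) "Hc \<equiv> carrier (hecke_H n t)"
abbreviation (input) "Rc \<equiv> carrier (rat_daha n t)"

lemma hecke_H_carrier: "Hc = generate_ring (trig_daha n t) (range (scal n t) \<union> Tgen n t ` {0..n})"
  by (simp add: hecke_H_def subalg_def)

lemma rat_daha_carrier: "Rc = generate_ring (trig_daha n t) (range (scal n t) \<union> (Hc \<union> Xgen n t ` {1..n}))"
  by (simp add: rat_daha_def subalg_def)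

lemma Hc_subset: "Hc \<subseteq> carrier (trig_daha n t)"
  unfolding hecke_H_carrier by (rule A.generate_ring_incl) (auto simp: scal_in Tgen_in)

lemma Rc_generators: "range (scal n t) \<union> (Hc \<union> Xgen n t ` {1..n}) \<subseteq> carrier (trig_daha n t)"
  using Hc_subset by (auto simp: scal_in Xgen_def intro!: polX_in polys.coord)

lemma Rc_subset: "Rc \<subseteq> carrier (trig_daha n t)"
  unfolding rat_daha_carrier by (rule A.generate_ring_incl[OF Rc_generators])

lemma Rc_in: "h \<in> Rc \<Longrightarrow> h \<in> carrier (trig_daha n t)"
  using Rc_subset by blast

lemma ring_rat_daha: "ring (rat_daha n t)"
  using A.generate_ring_is_ring[OF Rc_generators] by (simp add: rat_daha_def subalg_def)

interpretation R: ring "rat_daha n t"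
  by (rule ring_rat_daha)

lemma Hc_Rc: "h \<in> Hc \<Longrightarrow> h \<in> Rc"
  unfolding rat_daha_carrier by (rule generate_ring.incl) simp

lemma scal_Hc: "scal n t c \<in> Hc"
  unfolding hecke_H_carrier by (rule generate_ring.incl) simp

lemma Tgen_Hc: "i \<le> n \<Longrightarrow> Tgen n t i \<in> Hc"
  unfolding hecke_H_carrier by (rule generate_ring.incl) simp

lemma polX_Rc: assumes "p \<in> polys n" shows "polX n t p \<in> Rc"
  using assms
proof induction
  case (const c)
  have "polX n t (\<lambda>x. c) = scal n t c"
    by (rule daha_op_eqI) (auto simp: polX_in scal_in polys.const daha_op_polX daha_op_scal)
  then show ?case using Hc_Rc[OF scal_Hc] by simp
next
  case (coord j)
  then show ?case unfolding rat_daha_carrier by (intro generate_ring.incl) (auto simp: Xgen_def)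
next
  case (add p q)
  have "polX n t (\<lambda>x. p x + q x) = polX n t p \<oplus>\<^bsub>rat_daha n t\<^esub> polX n t q"
    using add by (intro daha_op_eqI) (auto simp: polX_in polys.add daha_op_polX daha_op_add algebra_simps)
  then show ?case using add by (simp only: R.a_closed)
next
  case (mult p q)
  have "polX n t (\<lambda>x. p x * q x) = polX n t p \<otimes>\<^bsub>rat_daha n t\<^esub> polX n t q"
    using mult by (intro daha_op_eqI) (auto simp: polX_in polys.mult daha_op_polX daha_op_mult algebra_simps)
  then show ?case using mult by (simp only: R.m_closed)
qed

lemma daha_op_a_inv:
  assumes "h \<in> Rc" "p \<in> polys n"
  shows "daha_op n t (\<ominus>\<^bsub>rat_daha n t\<^esub> h) p = (\<lambda>x. - daha_op n t h p x)"
proof -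
  have "h \<oplus>\<^bsub>trig_daha n t\<^esub> (\<ominus>\<^bsub>rat_daha n t\<^esub> h) = \<zero>\<^bsub>trig_daha n t\<^esub>"
    using R.r_neg[OF assms(1)] by simp
  then have "(\<lambda>x. daha_op n t h p x + daha_op n t (\<ominus>\<^bsub>rat_daha n t\<^esub> h) p x) = (\<lambda>x. 0)"
    using daha_op_add[OF Rc_in[OF assms(1)] Rc_in[OF R.a_inv_closed[OF assms(1)]] assms(2)] daha_op_zero[OF assms(2)] by simp
  then show ?thesis by (auto simp: fun_eq_iff add_eq_0_iff)
qed

lemma daha_op_minus:
  assumes "h \<in> Rc" "g \<in> Rc" "p \<in> polys n"
  shows "daha_op n t (h \<ominus>\<^bsub>rat_daha n t\<^esub> g) p = (\<lambda>x. daha_op n t h p x - daha_op n t g p x)"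
  using assms by (simp add: a_minus_def daha_op_add Rc_in R.a_inv_closed daha_op_a_inv)

lemma trig_a_inv: "h \<in> Rc \<Longrightarrow> \<ominus>\<^bsub>trig_daha n t\<^esub> h = \<ominus>\<^bsub>rat_daha n t\<^esub> h"
  by (rule A.minus_equality) (use R.l_neg[of h] in \<open>auto simp: Rc_in\<close>)

lemma Rc_eqI:
  assumes "h \<in> Rc" "g \<in> Rc" "\<And>p. p \<in> polys n \<Longrightarrow> daha_op n t h p = daha_op n t g p"
  shows "h = g"
  using assms daha_op_eqI Rc_in by blast

lemma Rc_closed: "h \<in> Rc \<Longrightarrow> g \<in> Rc \<Longrightarrow> h \<otimes>\<^bsub>trig_daha n t\<^esub> g \<in> Rc" "h \<in> Rc \<Longrightarrow> g \<in> Rc \<Longrightarrow> h \<oplus>\<^bsub>trig_daha n t\<^esub> g \<in> Rc"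
  "\<one>\<^bsub>trig_daha n t\<^esub> \<in> Rc" "\<zero>\<^bsub>trig_daha n t\<^esub> \<in> Rc"
  "h \<in> Rc \<Longrightarrow> g \<in> Rc \<Longrightarrow> h \<ominus>\<^bsub>rat_daha n t\<^esub> g \<in> Rc" "h \<in> Rc \<Longrightarrow> \<ominus>\<^bsub>rat_daha n t\<^esub> h \<in> Rc"
  using R.m_closed[of h g] R.a_closed[of h g] R.one_closed R.zero_closed R.minus_closed[of h g] R.a_inv_closed[of h] by auto

section \<open>The character of \<open>H\<close> on constants\<close>

definition const_char :: "free set \<Rightarrow> complex" where
  "const_char h = daha_op n t h (\<lambda>x. 1) (\<lambda>j. 0)"

text \<open>The generators of \<open>H\<close> preserve the line of constants, hence so does all of
  \<open>H\<close>.\<close>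

lemma daha_op_const_char:
  assumes "h \<in> Hc"
  shows "daha_op n t h (\<lambda>x. c) = (\<lambda>x. const_char h * c)"
proof -
  have one: "\<exists>d. daha_op n t h (\<lambda>x. 1) = (\<lambda>x. d)" if "h \<in> Hc" for h
    using that unfolding hecke_H_carrier
  proof (induction h rule: generate_ring.induct)
    case one then show ?case using daha_op_one[OF polys.const] by auto
  next
    case (incl h) then show ?case by (auto simp: daha_op_scal daha_op_Tgen_const polys.const)
  next
    case (a_inv h)
    then have "h \<in> Rc" using Hc_Rc hecke_H_carrier by simp
    then show ?case using a_inv by (auto simp: trig_a_inv daha_op_a_inv polys.const)
  next
    case (eng_add h g)
    then have "h \<in> Rc" "g \<in> Rc" using Hc_Rc hecke_H_carrier by simp_all
    then show ?case using eng_add by (auto simp: daha_op_add Rc_in polys.const)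
  next
    case (eng_mult h g)
    then have hg: "h \<in> Rc" "g \<in> Rc" using Hc_Rc hecke_H_carrier by simp_all
    obtain c d where "daha_op n t h (\<lambda>x. 1) = (\<lambda>x. c)" "daha_op n t g (\<lambda>x. 1) = (\<lambda>x. d)"
      using eng_mult.IH by blast
    then show ?case
      using daha_op_scale_arg[OF Rc_in[OF hg(1)] polys.const, of d 1] hg
      by (auto simp: daha_op_mult Rc_in polys.const)
  qed
  obtain d where d: "daha_op n t h (\<lambda>x. 1) = (\<lambda>x. d)" using one[OF assms] by blast
  have "daha_op n t h (\<lambda>x. c * 1) = (\<lambda>x. c * d)"
    using daha_op_scale_arg[OF Rc_in[OF Hc_Rc[OF assms]] polys.const, of c 1] d by simp
  then show ?thesis by (simp add: const_char_def d mult.commute)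
qed

text \<open>Makes the definite description in the definition meaningful: the scalar by which
  \<open>h\<close> acts on constants is a character with the prescribed values, and its values on
  the generators determine it.\<close>

lemma triv_char: assumes "h \<in> Hc" shows "triv_char n t h = const_char h"
proof -
  have Hc_closed: "h \<otimes>\<^bsub>trig_daha n t\<^esub> g \<in> Hc" "h \<oplus>\<^bsub>trig_daha n t\<^esub> g \<in> Hc" "\<one>\<^bsub>trig_daha n t\<^esub> \<in> Hc"
    "\<zero>\<^bsub>trig_daha n t\<^esub> \<in> Hc" "\<ominus>\<^bsub>trig_daha n t\<^esub> h \<in> Hc" if "h \<in> Hc" "g \<in> Hc" for h g
    using that unfolding hecke_H_carrier by (auto intro: generate_ring.intros A.zero_in_generate)
  let ?f = "restrict const_char Hc"
  have "?f \<in> alg_hom (hecke_H n t) (scal n t) complex_ring (\<lambda>c. c)"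
    unfolding alg_hom_def
  proof (intro CollectI conjI ring_hom_memI allI)
    fix h g assume hg: "h \<in> Hc" "g \<in> Hc"
    show "?f (h \<otimes>\<^bsub>hecke_H n t\<^esub> g) = ?f h \<otimes>\<^bsub>complex_ring\<^esub> ?f g"
      using hg Hc_closed[OF hg] daha_op_const_char[OF hg(1), of "const_char g"] daha_op_const_char[OF hg(2), of 1]
        daha_op_mult[OF Rc_in[OF Hc_Rc] Rc_in[OF Hc_Rc] polys.const, OF hg, of 1]
      by (simp add: complex_ring_def const_char_def[of "_ \<otimes>\<^bsub>_\<^esub> _"])
    show "?f (h \<oplus>\<^bsub>hecke_H n t\<^esub> g) = ?f h \<oplus>\<^bsub>complex_ring\<^esub> ?f g"
      using hg Hc_closed[OF hg] daha_op_add[OF Rc_in[OF Hc_Rc] Rc_in[OF Hc_Rc] polys.const, OF hg, of 1]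
      by (simp add: complex_ring_def const_char_def)
  next
    show "?f \<one>\<^bsub>hecke_H n t\<^esub> = \<one>\<^bsub>complex_ring\<^esub>"
      using Hc_closed[OF assms assms] daha_op_one[OF polys.const, of 1] by (simp add: complex_ring_def const_char_def)
    show "?f (scal n t c) = c" for c
      using scal_Hc daha_op_scal[OF polys.const, of c 1] by (simp add: const_char_def)
  qed (simp add: complex_ring_def)
  moreover have "?f (Tgen n t i) = chi n t i" if "i \<le> n" for i
    using Tgen_Hc[OF that] daha_op_Tgen_const[OF that, of 1] by (simp add: const_char_def)
  moreover have "f = ?f" if f: "f \<in> extensional Hc" "f \<in> alg_hom (hecke_H n t) (scal n t) complex_ring (\<lambda>c. c)"
    "\<forall>i\<le>n. f (Tgen n t i) = chi n t i" for f
  proof (rule extensionalityI[OF f(1)])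
    define g where "g = ?f"
    have alg: "g \<in> alg_hom (hecke_H n t) (scal n t) complex_ring (\<lambda>c. c)"
      and g: "\<And>i. i \<le> n \<Longrightarrow> g (Tgen n t i) = chi n t i"
      unfolding g_def by fact+
    have hom: "g (h \<otimes>\<^bsub>trig_daha n t\<^esub> k) = g h * g k" "g (h \<oplus>\<^bsub>trig_daha n t\<^esub> k) = g h + g k"
       "g \<one>\<^bsub>trig_daha n t\<^esub> = 1" "g (scal n t c) = c"
      if "g \<in> alg_hom (hecke_H n t) (scal n t) complex_ring (\<lambda>c. c)" "h \<in> Hc" "k \<in> Hc" for g h k c
      using that ring_hom_mult[of g "hecke_H n t" complex_ring h k] ring_hom_add[of g "hecke_H n t" complex_ring h k]
        ring_hom_one[of g "hecke_H n t" complex_ring]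
      by (auto simp: alg_hom_def complex_ring_def)
    have hom_inv: "g (\<ominus>\<^bsub>trig_daha n t\<^esub> h) = - g h"
      if "g \<in> alg_hom (hecke_H n t) (scal n t) complex_ring (\<lambda>c. c)" "h \<in> Hc" for g h
    proof -
      have "g \<zero>\<^bsub>trig_daha n t\<^esub> = 0" using hom(2)[OF that(1), of "\<zero>\<^bsub>trig_daha n t\<^esub>" "\<zero>\<^bsub>trig_daha n t\<^esub>"]
          Hc_closed[OF that(2,2)] by simp
      moreover have "h \<oplus>\<^bsub>trig_daha n t\<^esub> (\<ominus>\<^bsub>trig_daha n t\<^esub> h) = \<zero>\<^bsub>trig_daha n t\<^esub>"
        using that(2) Hc_subset A.r_neg by blast
      ultimately show ?thesis
        using hom(2)[OF that Hc_closed(5)[OF that(2,2)]] by (simp add: add_eq_0_iff)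
    qed
    have "f h = g h" if "h \<in> Hc" for h
      using that unfolding hecke_H_carrier
    proof (induction h rule: generate_ring.induct)
      case one then show ?case using hom(3)[OF f(2) assms assms] hom(3)[OF alg assms assms] by simp
    next
      case (incl h)
      then show ?case using hom(4)[OF f(2) assms assms] hom(4)[OF alg assms assms] f(3) g by auto
    next
      case (a_inv h) then show ?case unfolding hecke_H_carrier[symmetric] by (simp add: hom_inv[OF f(2)] hom_inv[OF alg])
    next
      case (eng_add h g) then show ?case unfolding hecke_H_carrier[symmetric] by (simp add: hom(2)[OF f(2)] hom(2)[OF alg])
    next
      case (eng_mult h g) then show ?case unfolding hecke_H_carrier[symmetric] by (simp add: hom(1)[OF f(2)] hom(1)[OF alg])
    qed
    then show "f h = ?f h" if "h \<in> Hc" for h using that unfolding g_def .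
  qed simp
  ultimately have "triv_char n t = ?f" unfolding triv_char_def
    by (intro the_equality) auto
  then show ?thesis using assms by simp
qed

section \<open>The left ideal defining the induced module\<close>

abbreviation (input) "K \<equiv> ind_kernel n t"

lemma ind_kernel_generators:
  "a \<in> Rc \<Longrightarrow> h \<in> Hc \<Longrightarrow> a \<otimes>\<^bsub>rat_daha n t\<^esub> (h \<ominus>\<^bsub>rat_daha n t\<^esub> scal n t (triv_char n t h)) \<in> Rc"
  by (simp add: Rc_closed Hc_Rc scal_Hc)

lemma ind_kernel_subgroup: "subgroup K (add_monoid (rat_daha n t))"
  unfolding ind_kernel_def
  by (rule group.generate_is_subgroup[OF R.a_group]) (use ind_kernel_generators in auto)

lemma ind_kernel_Rc: "k \<in> K \<Longrightarrow> k \<in> Rc"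
  using subgroup.mem_carrier[OF ind_kernel_subgroup] by simp

lemma ind_kernel_add: "k \<in> K \<Longrightarrow> l \<in> K \<Longrightarrow> k \<oplus>\<^bsub>rat_daha n t\<^esub> l \<in> K"
  using subgroup.m_closed[OF ind_kernel_subgroup] by simp

lemma ind_kernel_a_inv: "k \<in> K \<Longrightarrow> \<ominus>\<^bsub>rat_daha n t\<^esub> k \<in> K"
  using subgroup.m_inv_closed[OF ind_kernel_subgroup] by (simp add: a_inv_def)

lemma ind_kernel_zero: "\<zero>\<^bsub>rat_daha n t\<^esub> \<in> K"
  using subgroup.one_closed[OF ind_kernel_subgroup] by simp

text \<open>\<open>ind_kernel\<close> is generated as an additive group only; it is a left ideal
  because its generating set absorbs left factors.\<close>

lemma ind_kernel_lmult:
  assumes "k \<in> K" "a \<in> Rc" shows "a \<otimes>\<^bsub>rat_daha n t\<^esub> k \<in> K"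
proof -
  have gen: "a \<otimes>\<^bsub>rat_daha n t\<^esub> (b \<otimes>\<^bsub>rat_daha n t\<^esub> (h \<ominus>\<^bsub>rat_daha n t\<^esub> scal n t (triv_char n t h))) \<in> K"
    if "b \<in> Rc" "h \<in> Hc" for b h
  proof -
    have "(a \<otimes>\<^bsub>rat_daha n t\<^esub> b) \<otimes>\<^bsub>rat_daha n t\<^esub> (h \<ominus>\<^bsub>rat_daha n t\<^esub> scal n t (triv_char n t h)) \<in> K"
      unfolding ind_kernel_def using that assms(2) R.m_closed by (intro generate.incl) blast
    moreover have "(a \<otimes>\<^bsub>rat_daha n t\<^esub> b) \<otimes>\<^bsub>rat_daha n t\<^esub> (h \<ominus>\<^bsub>rat_daha n t\<^esub> scal n t (triv_char n t h)) =
      a \<otimes>\<^bsub>rat_daha n t\<^esub> (b \<otimes>\<^bsub>rat_daha n t\<^esub> (h \<ominus>\<^bsub>rat_daha n t\<^esub> scal n t (triv_char n t h)))"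
      using that assms(2) Hc_Rc scal_Hc by (intro R.m_assoc R.minus_closed) auto
    ultimately show ?thesis by metis
  qed
  show ?thesis using assms(1) unfolding ind_kernel_def
  proof (induction k rule: generate.induct)
    case one
    then show ?case using R.r_null[OF assms(2)] generate.one[of "add_monoid (rat_daha n t)"] by simp
  next
    case (incl k)
    then show ?case using gen unfolding ind_kernel_def by blast
  next
    case (inv k)
    then obtain b h where k: "b \<in> Rc" "h \<in> Hc" "k = b \<otimes>\<^bsub>rat_daha n t\<^esub> (h \<ominus>\<^bsub>rat_daha n t\<^esub> scal n t (triv_char n t h))"
      by blast
    have "a \<otimes>\<^bsub>rat_daha n t\<^esub> (\<ominus>\<^bsub>rat_daha n t\<^esub> k) = \<ominus>\<^bsub>rat_daha n t\<^esub> (a \<otimes>\<^bsub>rat_daha n t\<^esub> k)"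
      using ind_kernel_generators[OF k(1,2)] k(3) assms(2) by (intro R.r_minus) auto
    then show ?case using ind_kernel_a_inv[OF gen[OF k(1,2)]] k(3) unfolding ind_kernel_def by (simp add: a_inv_def)
  next
    case (eng k l)
    then have "k \<in> Rc" "l \<in> Rc" using ind_kernel_Rc unfolding ind_kernel_def by auto
    then have "a \<otimes>\<^bsub>rat_daha n t\<^esub> (k \<oplus>\<^bsub>rat_daha n t\<^esub> l) = (a \<otimes>\<^bsub>rat_daha n t\<^esub> k) \<oplus>\<^bsub>rat_daha n t\<^esub> (a \<otimes>\<^bsub>rat_daha n t\<^esub> l)"
      using assms(2) by (intro R.r_distr)
    then show ?case using ind_kernel_add eng.IH unfolding ind_kernel_def by (simp only: monoid.simps)
  qed
qed

text \<open>Each \<open>h - \<chi>(h)\<close> kills the constant 1. Since \<open>p(X)\<close> sends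
  1 to \<open>p\<close>, this makes polynomials inject into the induced module.\<close>

lemma daha_op_ind_kernel:
  assumes "k \<in> K" shows "daha_op n t k (\<lambda>x. 1) = (\<lambda>x. 0)"
proof -
  have gen: "k \<in> Rc \<and> daha_op n t k (\<lambda>x. 1) = (\<lambda>x. 0)"
    if k: "k = a \<otimes>\<^bsub>rat_daha n t\<^esub> (h \<ominus>\<^bsub>rat_daha n t\<^esub> scal n t (triv_char n t h))" "a \<in> Rc" "h \<in> Hc" for k a h
  proof
    show "k \<in> Rc" using k ind_kernel_generators by blast
    have "daha_op n t (h \<ominus>\<^bsub>rat_daha n t\<^esub> scal n t (triv_char n t h)) (\<lambda>x. 1) = (\<lambda>x. 0)"
      using k Hc_Rc scal_Hc by (simp add: daha_op_minus polys.const daha_op_scal triv_char daha_op_const_char[OF k(3)])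
    moreover have "daha_op n t a (\<lambda>x. 0) = (\<lambda>x. 0)"
      using daha_op_scale_arg[OF Rc_in[OF k(2)] polys.const, of 0 0] by simp
    ultimately show "daha_op n t k (\<lambda>x. 1) = (\<lambda>x. 0)"
      using k Hc_Rc scal_Hc by (simp add: daha_op_mult Rc_in Rc_closed polys.const)
  qed
  show ?thesis using assms unfolding ind_kernel_def
  proof (induction k rule: generate.induct)
    case one then show ?case by (simp add: daha_op_zero polys.const)
  next
    case (incl k) then show ?case using gen by blast
  next
    case (inv k)
    then have "k \<in> Rc \<and> daha_op n t k (\<lambda>x. 1) = (\<lambda>x. 0)" using gen by blast
    then show ?case using daha_op_a_inv[OF _ polys.const, of k 1] by (simp add: a_inv_def)
  next
    case (eng k l)
    then have "k \<in> Rc" "l \<in> Rc" using ind_kernel_Rc unfolding ind_kernel_def by auto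
    then show ?case using eng.IH by (simp add: daha_op_add Rc_in polys.const)
  qed
qed

section \<open>Comparison of the induced action with the operators\<close>

definition reduces :: "free set \<Rightarrow> bool" where
  "reduces h \<longleftrightarrow> h \<in> Rc \<and> (\<forall>p\<in>polys n. (h \<otimes>\<^bsub>rat_daha n t\<^esub> polX n t p) \<ominus>\<^bsub>rat_daha n t\<^esub> polX n t (daha_op n t h p) \<in> K)"

lemmas Rc_intros = Rc_closed polX_Rc daha_op_polys Rc_in Hc_Rc scal_Hc Tgen_Hc polys_intros

lemmas daha_op_simps = daha_op_minus daha_op_add daha_op_mult daha_op_polX daha_op_a_inv daha_op_zero
  daha_op_one daha_op_scal

text \<open>By faithfulness, \<open>h p(X) - (h p)(X)\<close> is the only element with operator
  \<open>f \<mapsto> h (p f) - (h p) f\<close>, so it lies in the kernel as soon as some kernel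
  element has this operator.\<close>

lemma reducesI:
  assumes "h \<in> Rc"
    and "\<And>p. p \<in> polys n \<Longrightarrow> \<exists>k\<in>K. \<forall>f\<in>polys n. daha_op n t k f = (\<lambda>x. daha_op n t h (\<lambda>x. p x * f x) x - daha_op n t h p x * f x)"
  shows "reduces h"
  unfolding reduces_def
proof (intro conjI ballI assms(1))
  fix p assume p: "p \<in> polys n"
  then obtain k where k: "k \<in> K" "\<forall>f\<in>polys n. daha_op n t k f = (\<lambda>x. daha_op n t h (\<lambda>x. p x * f x) x - daha_op n t h p x * f x)"
    using assms(2) by blast
  have "(h \<otimes>\<^bsub>rat_daha n t\<^esub> polX n t p) \<ominus>\<^bsub>rat_daha n t\<^esub> polX n t (daha_op n t h p) = k"
    using assms(1) p k ind_kernel_Rc[OF k(1)]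
    by (intro Rc_eqI) (auto simp: daha_op_simps Rc_intros)
  then show "(h \<otimes>\<^bsub>rat_daha n t\<^esub> polX n t p) \<ominus>\<^bsub>rat_daha n t\<^esub> polX n t (daha_op n t h p) \<in> K" using k by simp
qed

lemma reducesD:
  assumes "reduces h" "p \<in> polys n"
  shows "\<exists>k\<in>K. \<forall>f\<in>polys n. daha_op n t k f = (\<lambda>x. daha_op n t h (\<lambda>x. p x * f x) x - daha_op n t h p x * f x)"
proof
  let ?k = "(h \<otimes>\<^bsub>rat_daha n t\<^esub> polX n t p) \<ominus>\<^bsub>rat_daha n t\<^esub> polX n t (daha_op n t h p)"
  show "?k \<in> K" using assms by (auto simp: reduces_def)
  show "\<forall>f\<in>polys n. daha_op n t ?k f = (\<lambda>x. daha_op n t h (\<lambda>x. p x * f x) x - daha_op n t h p x * f x)"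
    using assms by (auto simp: reduces_def daha_op_simps Rc_intros)
qed

text \<open>A multiplication operator commutes with multiplication by \<open>p\<close>, so the
  required operator is zero.\<close>

lemma reduces_multiplication:
  assumes "h \<in> Rc" "r \<in> polys n" "\<And>p. p \<in> polys n \<Longrightarrow> daha_op n t h p = (\<lambda>x. r x * p x)"
  shows "reduces h"
  using assms ind_kernel_zero by (intro reducesI bexI[of _ "\<zero>\<^bsub>rat_daha n t\<^esub>"]) (auto simp: daha_op_zero polys.mult mult.assoc)

lemma reduces_Tgen: assumes i: "i \<le> n" shows "reduces (Tgen n t i)"
proof (rule reducesI)
  show "Tgen n t i \<in> Rc" using i by (simp add: Rc_intros)
  fix p assume p: "p \<in> polys n"
  \<comment> \<open>Read off from the twisted Leibniz rule
    \<open>T_i (p f) - (T_i p) f = (s_i p) (T_i f - \<chi>_i f)\<close>, a consequence of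
    \<open>c_i - d_i = \<chi>_i\<close>.\<close>
  let ?k = "polX n t (refl_act n i p) \<otimes>\<^bsub>rat_daha n t\<^esub> (Tgen n t i \<ominus>\<^bsub>rat_daha n t\<^esub> scal n t (triv_char n t (Tgen n t i)))"
  have sp: "refl_act n i p \<in> polys n" using n i p by (rule polys_refl_act)
  have "?k \<in> K" unfolding ind_kernel_def using Tgen_Hc[OF i] polX_Rc[OF sp] by (intro generate.incl) blast
  moreover have "daha_op n t ?k f = (\<lambda>x. daha_op n t (Tgen n t i) (\<lambda>x. p x * f x) x - daha_op n t (Tgen n t i) p x * f x)"
    if f: "f \<in> polys n" for f
  proof -
    have chi: "triv_char n t (Tgen n t i) = chi n t i"
      using triv_char[OF Tgen_Hc[OF i]] daha_op_Tgen_const[OF i, of 1] by (simp add: const_char_def)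
    have "daha_op n t ?k f = (\<lambda>x. refl_act n i p x * (daha_op n t (Tgen n t i) f x - chi n t i * f x))"
      using i p f sp chi by (simp add: daha_op_simps Rc_intros)
    also have "\<dots> = (\<lambda>x. daha_op n t (Tgen n t i) (\<lambda>x. p x * f x) x - daha_op n t (Tgen n t i) p x * f x)"
    proof (rule polys_eqI_aroot[OF n _ _ i])
      fix x assume x: "aroot n i x \<noteq> 0"
      show "refl_act n i p x * (daha_op n t (Tgen n t i) f x - chi n t i * f x) =
         daha_op n t (Tgen n t i) (\<lambda>x. p x * f x) x - daha_op n t (Tgen n t i) p x * f x"
        using i p f x by (simp add: daha_op_Tgen polys.mult cfct_def refl_act_def algebra_simps)
    qed (use i p f sp Tgen_in[OF i] in \<open>auto intro!: polys_intros daha_op_polys\<close>)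
    finally show ?thesis .
  qed
  ultimately show "\<exists>k\<in>K. \<forall>f\<in>polys n. daha_op n t k f =
     (\<lambda>x. daha_op n t (Tgen n t i) (\<lambda>x. p x * f x) x - daha_op n t (Tgen n t i) p x * f x)" by blast
qed

lemma reduces_add: assumes "reduces h" "reduces g" shows "reduces (h \<oplus>\<^bsub>trig_daha n t\<^esub> g)"
proof (rule reducesI)
  have hg: "h \<in> Rc" "g \<in> Rc" using assms by (auto simp: reduces_def)
  then show "h \<oplus>\<^bsub>trig_daha n t\<^esub> g \<in> Rc" by (rule Rc_closed)
  fix p assume p: "p \<in> polys n"
  obtain k where k: "k \<in> K"
    "\<And>f. f \<in> polys n \<Longrightarrow> daha_op n t k f = (\<lambda>x. daha_op n t h (\<lambda>x. p x * f x) x - daha_op n t h p x * f x)"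
    using reducesD[OF assms(1) p] by blast
  obtain l where l: "l \<in> K"
    "\<And>f. f \<in> polys n \<Longrightarrow> daha_op n t l f = (\<lambda>x. daha_op n t g (\<lambda>x. p x * f x) x - daha_op n t g p x * f x)"
    using reducesD[OF assms(2) p] by blast
  show "\<exists>k\<in>K. \<forall>f\<in>polys n. daha_op n t k f = (\<lambda>x. daha_op n t (h \<oplus>\<^bsub>trig_daha n t\<^esub> g) (\<lambda>x. p x * f x) x - daha_op n t (h \<oplus>\<^bsub>trig_daha n t\<^esub> g) p x * f x)"
    using ind_kernel_add[OF k(1) l(1)] k l p hg
    by (intro bexI[of _ "k \<oplus>\<^bsub>trig_daha n t\<^esub> l"]) (auto simp: ind_kernel_Rc daha_op_add Rc_in polys.mult algebra_simps)
qed

lemma reduces_a_inv: assumes "reduces h" shows "reduces (\<ominus>\<^bsub>trig_daha n t\<^esub> h)"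
proof (rule reducesI)
  have h: "h \<in> Rc" using assms by (auto simp: reduces_def)
  note eq = trig_a_inv[OF h]
  show "\<ominus>\<^bsub>trig_daha n t\<^esub> h \<in> Rc" unfolding eq using h by (rule Rc_closed)
  fix p assume p: "p \<in> polys n"
  obtain k where k: "k \<in> K"
    "\<And>f. f \<in> polys n \<Longrightarrow> daha_op n t k f = (\<lambda>x. daha_op n t h (\<lambda>x. p x * f x) x - daha_op n t h p x * f x)"
    using reducesD[OF assms(1) p] by blast
  show "\<exists>k\<in>K. \<forall>f\<in>polys n. daha_op n t k f = (\<lambda>x. daha_op n t (\<ominus>\<^bsub>trig_daha n t\<^esub> h) (\<lambda>x. p x * f x) x - daha_op n t (\<ominus>\<^bsub>trig_daha n t\<^esub> h) p x * f x)"
    unfolding eq using ind_kernel_a_inv[OF k(1)] k p h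
    by (intro bexI[of _ "\<ominus>\<^bsub>rat_daha n t\<^esub> k"]) (auto simp: ind_kernel_Rc daha_op_a_inv polys.mult)
qed

lemma reduces_mult: assumes "reduces h" "reduces g" shows "reduces (h \<otimes>\<^bsub>trig_daha n t\<^esub> g)"
proof (rule reducesI)
  have hg: "h \<in> Rc" "g \<in> Rc" using assms by (auto simp: reduces_def)
  then show "h \<otimes>\<^bsub>trig_daha n t\<^esub> g \<in> Rc" by (rule Rc_closed)
  fix p assume p: "p \<in> polys n"
  obtain l where l: "l \<in> K"
    "\<And>f. f \<in> polys n \<Longrightarrow> daha_op n t l f = (\<lambda>x. daha_op n t g (\<lambda>x. p x * f x) x - daha_op n t g p x * f x)"
    using reducesD[OF assms(2) p] by blast
  have gp: "daha_op n t g p \<in> polys n" using hg p by (simp add: Rc_intros)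
  obtain k where k: "k \<in> K"
    "\<And>f. f \<in> polys n \<Longrightarrow> daha_op n t k f = (\<lambda>x. daha_op n t h (\<lambda>x. daha_op n t g p x * f x) x - daha_op n t h (daha_op n t g p) x * f x)"
    using reducesD[OF assms(1) gp] by blast
  \<comment> \<open>The defect of a product at \<open>p\<close> is \<open>h\<close> times the defect
    of \<open>g\<close> at \<open>p\<close>, plus the defect of \<open>h\<close> at
    \<open>g p\<close>. The first summand is in the kernel because that is a left ideal.\<close>
  let ?k = "(h \<otimes>\<^bsub>trig_daha n t\<^esub> l) \<oplus>\<^bsub>trig_daha n t\<^esub> k"
  have "?k \<in> K" using ind_kernel_add[OF ind_kernel_lmult[OF l(1) hg(1)] k(1)] by simp
  moreover have "daha_op n t ?k f = (\<lambda>x. daha_op n t (h \<otimes>\<^bsub>trig_daha n t\<^esub> g) (\<lambda>x. p x * f x) x - daha_op n t (h \<otimes>\<^bsub>trig_daha n t\<^esub> g) p x * f x)"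
    if f: "f \<in> polys n" for f
  proof -
    let ?a = "daha_op n t g (\<lambda>x. p x * f x)" and ?b = "\<lambda>x. daha_op n t g p x * f x"
    have ab: "?a \<in> polys n" "?b \<in> polys n" using hg p f by (auto simp: Rc_intros)
    have "daha_op n t h (\<lambda>x. ?a x + (- 1) * ?b x) = (\<lambda>x. daha_op n t h ?a x + daha_op n t h (\<lambda>x. (- 1) * ?b x) x)"
      by (intro daha_op_add_arg Rc_in hg ab polys.mult[OF polys.const ab(2)])
    also have "daha_op n t h (\<lambda>x. (- 1) * ?b x) = (\<lambda>x. (- 1) * daha_op n t h ?b x)"
      using hg ab by (intro daha_op_scale_arg Rc_in)
    finally have "daha_op n t h (\<lambda>x. ?a x - ?b x) = (\<lambda>x. daha_op n t h ?a x - daha_op n t h ?b x)" by simp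
    then show ?thesis
      using hg l k ab by (simp add: gp p f ind_kernel_Rc daha_op_add daha_op_mult Rc_in Rc_closed polys.mult)
  qed
  ultimately show "\<exists>k\<in>K. \<forall>f\<in>polys n. daha_op n t k f = (\<lambda>x. daha_op n t (h \<otimes>\<^bsub>trig_daha n t\<^esub> g) (\<lambda>x. p x * f x) x - daha_op n t (h \<otimes>\<^bsub>trig_daha n t\<^esub> g) p x * f x)"
    by blast
qed

lemma reduces_one: "reduces \<one>\<^bsub>trig_daha n t\<^esub>"
  by (rule reduces_multiplication[of _ "\<lambda>x. 1"]) (auto simp: Rc_closed polys.const daha_op_one)

lemma reduces_scal: "reduces (scal n t c)"
  by (rule reduces_multiplication[of _ "\<lambda>x. c"]) (auto simp: Rc_intros daha_op_scal)

lemma reduces_Hc: "h \<in> Hc \<Longrightarrow> reduces h"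
  unfolding hecke_H_carrier
  by (induction h rule: generate_ring.induct) (auto intro: reduces_one reduces_scal reduces_Tgen reduces_add reduces_a_inv reduces_mult)

lemma reduces_Rc: "h \<in> Rc \<Longrightarrow> reduces h"
  unfolding rat_daha_carrier
proof (induction h rule: generate_ring.induct)
  case (incl h)
  have "reduces (Xgen n t j)" if "j \<in> {1..n}" for j
    using that by (intro reduces_multiplication[of _ "\<lambda>x. x j"]) (auto simp: Xgen_def intro!: polX_Rc polys.coord daha_op_polX)
  with incl show ?case by (auto intro: reduces_scal reduces_Hc)
qed (auto intro: reduces_one reduces_add reduces_a_inv reduces_mult)

text \<open>\<open>reduces_Rc\<close> provides a polynomial for the definite description. Any other
  candidate differs from it modulo the kernel only, and applying both to the constant 1 shows that
  they agree.\<close>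

lemma poly_rep_eq:
  assumes "h \<in> Rc" "p \<in> polys n"
  shows "poly_rep n t h p = daha_op n t h p"
proof -
  have eq: "ind_class n t a = ind_class n t b \<longleftrightarrow> a \<ominus>\<^bsub>rat_daha n t\<^esub> b \<in> K" if "a \<in> Rc" "b \<in> Rc" for a b
    unfolding ind_class_def by (rule R.a_coset_eq_iff[OF ind_kernel_subgroup that])
  have hp: "h \<otimes>\<^bsub>rat_daha n t\<^esub> polX n t p \<in> Rc" "polX n t (daha_op n t h p) \<in> Rc" "daha_op n t h p \<in> polys n"
    using assms by (auto simp: Rc_intros)
  have "(THE q. q \<in> polys n \<and> ind_class n t (polX n t q) = ind_class n t (h \<otimes>\<^bsub>rat_daha n t\<^esub> polX n t p)) = daha_op n t h p"
  proof (rule the_equality)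
    have "ind_class n t (h \<otimes>\<^bsub>rat_daha n t\<^esub> polX n t p) = ind_class n t (polX n t (daha_op n t h p))"
      using reduces_Rc[OF assms(1)] assms(2) unfolding eq[OF hp(1,2)] reduces_def by blast
    then show "daha_op n t h p \<in> polys n \<and>
        ind_class n t (polX n t (daha_op n t h p)) = ind_class n t (h \<otimes>\<^bsub>rat_daha n t\<^esub> polX n t p)"
      using hp by simp
    fix q assume q: "q \<in> polys n \<and> ind_class n t (polX n t q) = ind_class n t (h \<otimes>\<^bsub>rat_daha n t\<^esub> polX n t p)"
    then have "polX n t q \<ominus>\<^bsub>rat_daha n t\<^esub> (h \<otimes>\<^bsub>rat_daha n t\<^esub> polX n t p) \<in> K"
      using eq[OF _ hp(1)] polX_Rc by blast
    from daha_op_ind_kernel[OF this] show "q = daha_op n t h p"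
      using q hp assms by (simp add: daha_op_simps Rc_intros fun_eq_iff)
  qed
  then show ?thesis using assms(2) by (simp add: poly_rep_def)
qed

lemma poly_rep_hom: "poly_rep n t \<in> alg_hom (rat_daha n t) (scal n t) (poly_End n) (poly_End_scal n)"
proof -
  have ext: "poly_rep n t h = restrict (daha_op n t h) (polys n)" if "h \<in> Rc" for h
    using that by (intro extensionalityI[of _ "polys n"]) (simp_all add: poly_rep_eq, simp add: poly_rep_def)
  have polys: "daha_op n t h p \<in> polys n" if "h \<in> Rc" "p \<in> polys n" for h p
    using that by (simp add: Rc_intros)
  show ?thesis unfolding alg_hom_def
  proof (intro CollectI conjI ring_hom_memI allI)
    show "poly_rep n t h \<in> carrier (poly_End n)" if "h \<in> Rc" for h
      using that by (auto simp: ext poly_End_def polys polys.intros daha_op_add_arg daha_op_scale_arg Rc_in)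
    fix h g assume hg: "h \<in> Rc" "g \<in> Rc"
    then show "poly_rep n t (h \<otimes>\<^bsub>rat_daha n t\<^esub> g) = poly_rep n t h \<otimes>\<^bsub>poly_End n\<^esub> poly_rep n t g"
      by (auto simp: ext Rc_closed poly_End_def compose_def daha_op_mult Rc_in polys fun_eq_iff restrict_def)
    show "poly_rep n t (h \<oplus>\<^bsub>rat_daha n t\<^esub> g) = poly_rep n t h \<oplus>\<^bsub>poly_End n\<^esub> poly_rep n t g"
      using hg by (auto simp: ext Rc_closed poly_End_def daha_op_add Rc_in polys fun_eq_iff restrict_def)
  next
    show "poly_rep n t \<one>\<^bsub>rat_daha n t\<^esub> = \<one>\<^bsub>poly_End n\<^esub>"
      by (auto simp: ext Rc_closed poly_End_def daha_op_one fun_eq_iff restrict_def)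
    show "poly_rep n t (scal n t c) = poly_End_scal n c" for c
      by (auto simp: ext Rc_intros poly_End_scal_def daha_op_scal fun_eq_iff restrict_def)
  qed
qed

end

text \<open>Where \<open>aroot n i\<close> vanishes, the quotients in \<open>cfct\<close> and
  \<open>dfct\<close> would take the conventional value 0, so the formula is asserted off that
  hyperplane; by \<open>polys_eqI_aroot\<close> this still determines the polynomial.\<close>

theorem proposition4p3:
  fixes n :: nat and t :: daha_params
  assumes "n \<ge> 2"
  shows "poly_rep n t \<in> alg_hom (rat_daha n t) (scal n t) (poly_End n) (poly_End_scal n) \<and>
    (\<forall>i\<le>n. \<forall>p\<in>polys n. \<forall>x. aroot n i x \<noteq> 0 \<longrightarrow>
       poly_rep n t (Tgen n t i) p x =
         cfct n t i x * refl_act n i p x - dfct n t i x * p x) \<and>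
    (\<forall>j\<in>{1..n}. \<forall>p\<in>polys n. \<forall>x. poly_rep n t (Xgen n t j) p x = x j * p x) \<and>
    inj_on (poly_rep n t) (carrier (rat_daha n t))"
proof (intro conjI)
  note n = assms
  show "poly_rep n t \<in> alg_hom (rat_daha n t) (scal n t) (poly_End n) (poly_End_scal n)"
    by (rule poly_rep_hom[OF n])
  show "\<forall>i\<le>n. \<forall>p\<in>polys n. \<forall>x. aroot n i x \<noteq> 0 \<longrightarrow>
       poly_rep n t (Tgen n t i) p x = cfct n t i x * refl_act n i p x - dfct n t i x * p x"
    by (auto simp: poly_rep_eq[OF n] daha_op_Tgen[OF n] Hc_Rc[OF n] Tgen_Hc[OF n])
  show "\<forall>j\<in>{1..n}. \<forall>p\<in>polys n. \<forall>x. poly_rep n t (Xgen n t j) p x = x j * p x"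
    by (auto simp: Xgen_def poly_rep_eq[OF n] polX_Rc[OF n] polys.coord daha_op_polX[OF n])
  show "inj_on (poly_rep n t) (carrier (rat_daha n t))"
  proof (rule inj_onI)
    fix h g assume hg: "h \<in> carrier (rat_daha n t)" "g \<in> carrier (rat_daha n t)" "poly_rep n t h = poly_rep n t g"
    \<comment> \<open>Faithfulness of the trigonometric algebra restricts to its subalgebra.\<close>
    then show "h = g" by (intro Rc_eqI[OF n]) (auto simp flip: poly_rep_eq[OF n])
  qed
qed

end
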